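(* Assume that problems (P) and (D) are both feasible. Let $\{(x_k,y_k,z_k)\}_{k=0}^{\infty}$ be generated by Algorithm PD-PMM. Furthermore, assume that the sequence $\{\epsilon_k\}_{k=0}^{\infty}$ of tolerances used in Algorithm PD-PMM is chosen such that $$\epsilon_k \leq \frac{\min\{\sqrt{\tau_k},1\}}{\beta_k}\,\delta_k,\qquad 0 \leq \delta_k,\qquad \sum_{k=0}^{\infty} \delta_k < \infty .$$ Then $\{(x_k,y_k,z_k)\}_{k=0}^{\infty}$ is bounded and converges to a primal-dual solution of (P)--(D).
   Context: Problem data: $c \in \mathbb{R}^n$, $Q \in \mathbb{R}^{n\times n}$ symmetric positive semidefinite, $A \in \mathbb{R}^{m\times n}$ with $m \le n$, $b\in\mathbb{R}^m$, $g(x)=\|Dx\|_1$ with $D\in\mathbb{R}^{n\times n}$ diagonal and positive semidefinite, and $\mathcal{K}=\{x\in\mathbb{R}^n : a_l\le x\le a_u\}$ where $a_l\le a_u$ are vectors whose entries may be infinite (i.e. bounds may be absent). $\delta_{\mathcal{K}}$ is the indicator function of $\mathcal{K}$ ($0$ on $\mathcal K$, $+\infty$ elsewhere), $^*$ on a function denotes the Fenchel conjugate, $\Pi_{\mathcal{C}}$ is the Euclidean projection onto a closed convex set $\mathcal{C}$, $\|\cdot\|$ is the Euclidean norm, $\partial$ is the convex subdifferential, and $\mathrm{dist}(p,\mathcal{C})=\inf_{p'\in\mathcal{C}}\|p-p'\|$. Primal problem (P): $\min_{x\in\mathbb{R}^n}\ c^\top x+\frac12 x^\top Qx+g(x)+\delta_{\mathcal{K}}(x)$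 subject to $Ax=b$. Dual problem (D): $\max_{x\in\mathbb{R}^n,\,y\in\mathbb{R}^m,\,z\in\mathbb{R}^n}\ b^\top y-\frac12 x^\top Qx-\delta_{\mathcal{K}}^*(z)-g^*(A^\top y-c-Qx-z)$. Feasible means that there is a point satisfying the constraints at which the objective is finite. A primal-dual solution of (P)--(D) is a triple $(x^*,y^*,z^* )$ such that $x^*$ is optimal for (P) and $(x^*,y^*,z^* )$ is optimal for (D). Algorithm PD-PMM (primal-dual proximal method of multipliers). Input: $(x_0,y_0,z_0)\in\mathbb{R}^n\times\mathbb{R}^m\times\mathbb{R}^n$; a sequence $\{\tau_k\}_{k\ge0}$ of positive numbers that is non-increasing with limit $\tau_\infty>0$; a non-decreasing sequence $\{\beta_k\}_{k\ge 0}$ with $\beta_0>0$ and $\beta_k\nearrow\beta_\infty\le\infty$; $\rho_k=\beta_k/\tau_k$; and positive tolerances $\epsilon_k\to0$. For $k=0,1,2,\dots$: find $(x_{k+1},y_{k+1})$ such that $$\mathrm{dist}\big(0,F_{\beta_k,\rho_k}(x_{k+1},y_{k+1})\big)\le\epsilon_k,$$ and set $z_{k+1}=(z_k+\beta_kx_{k+1})-\beta_k\Pi_{\mathcal{K}}(\beta_k^{-1}z_k+x_{k+1})$. Here $$r_{\beta_k,\rho_k}(x,y)=c+Qx-A^\top y+(z_k+\beta_kx)-\beta_k\Pi_{\mathcal{K}}(\beta_k^{-1}z_k+x)+\rho_k^{-1}(x-x_k),$$ $$F_{\beta_k,\rho_k}(x,y)=\big\{(u',v')\in\mathbb{R}^n\times\mathbb{R}^m:\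 u'\in r_{\beta_k,\rho_k}(x,y)+\partial g(x),\ v'=Ax+\beta_k^{-1}(y-y_k)-b\big\}.$$ *)

theory Defs
  imports "HOL-Analysis.Analysis"
begin

section \<open>Convex-analytic notions\<close>

definition psd :: "real ^ 'n ^ 'n \<Rightarrow> bool" where
  "psd M \<longleftrightarrow> transpose M = M \<and> (\<forall>x. 0 \<le> x \<bullet> (M *v x))"

definition diagonal :: "real ^ 'n ^ 'n \<Rightarrow> bool" where
  "diagonal M \<longleftrightarrow> (\<forall>i j. i \<noteq> j \<longrightarrow> M $ i $ j = 0)"

definition l1_norm :: "real ^ 'n \<Rightarrow> real" where
  "l1_norm x = (\<Sum>i\<in>UNIV. \<bar>x $ i\<bar>)"

definition convex_indicator :: "'a set \<Rightarrow> 'a \<Rightarrow> ereal" where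
  "convex_indicator C x = (if x \<in> C then 0 else \<infinity>)"

definition fenchel_conjugate :: "('a::real_inner \<Rightarrow> ereal) \<Rightarrow> 'a \<Rightarrow> ereal" where
  "fenchel_conjugate f s = (SUP x. ereal (s \<bullet> x) - f x)"

definition subdifferential :: "('a::real_inner \<Rightarrow> real) \<Rightarrow> 'a \<Rightarrow> 'a set" where
  "subdifferential f x = {s. \<forall>w. f x + s \<bullet> (w - x) \<le> f w}"

section \<open>The primal-dual pair\<close>

text \<open>An absent bound is encoded by an infinite entry of the bound vector.\<close>

definition box_set :: "ereal ^ 'n \<Rightarrow> ereal ^ 'n \<Rightarrow> (real ^ 'n) set" where
  "box_set al au = {x. \<forall>i. al $ i \<le> ereal (x $ i) \<and> ereal (x $ i) \<le> au $ i}"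

definition reg :: "real ^ 'n ^ 'n \<Rightarrow> real ^ 'n \<Rightarrow> real" where
  "reg D x = l1_norm (D *v x)"

definition primal_objective ::
  "real ^ 'n \<Rightarrow> real ^ 'n ^ 'n \<Rightarrow> real ^ 'n ^ 'n \<Rightarrow> (real ^ 'n) set \<Rightarrow> real ^ 'n \<Rightarrow> ereal" where
  "primal_objective c Q D K x =
     ereal (c \<bullet> x + 1/2 * (x \<bullet> (Q *v x)) + reg D x) + convex_indicator K x"

text \<open>For nonempty \<open>K\<close> neither conjugate takes the value \<open>-\<infinity>\<close>, so the
  differences below never meet an undefined \<open>\<infinity> - \<infinity>\<close>.\<close>

definition dual_objective ::
  "real ^ 'n \<Rightarrow> real ^ 'n ^ 'n \<Rightarrow> real ^ 'n ^ 'm \<Rightarrow> real ^ 'm \<Rightarrow> real ^ 'n ^ 'n \<Rightarrow> (real ^ 'n) set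
     \<Rightarrow> (real ^ 'n) \<times> (real ^ 'm) \<times> (real ^ 'n) \<Rightarrow> ereal" where
  "dual_objective c Q A b D K = (\<lambda>(x, y, z).
     ereal (b \<bullet> y - 1/2 * (x \<bullet> (Q *v x)))
       - fenchel_conjugate (convex_indicator K) z
       - fenchel_conjugate (\<lambda>x. ereal (reg D x)) (transpose A *v y - c - Q *v x - z))"

definition primal_feasible_point ::
  "real ^ 'n \<Rightarrow> real ^ 'n ^ 'n \<Rightarrow> real ^ 'n ^ 'm \<Rightarrow> real ^ 'm \<Rightarrow> real ^ 'n ^ 'n \<Rightarrow> (real ^ 'n) set
     \<Rightarrow> real ^ 'n \<Rightarrow> bool" where
  "primal_feasible_point c Q A b D K x \<longleftrightarrow>
     A *v x = b \<and> \<bar>primal_objective c Q D K x\<bar> \<noteq> \<infinity>"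

definition dual_feasible_point ::
  "real ^ 'n \<Rightarrow> real ^ 'n ^ 'n \<Rightarrow> real ^ 'n ^ 'm \<Rightarrow> real ^ 'm \<Rightarrow> real ^ 'n ^ 'n \<Rightarrow> (real ^ 'n) set
     \<Rightarrow> (real ^ 'n) \<times> (real ^ 'm) \<times> (real ^ 'n) \<Rightarrow> bool" where
  "dual_feasible_point c Q A b D K w \<longleftrightarrow> \<bar>dual_objective c Q A b D K w\<bar> \<noteq> \<infinity>"

definition primal_dual_solution ::
  "real ^ 'n \<Rightarrow> real ^ 'n ^ 'n \<Rightarrow> real ^ 'n ^ 'm \<Rightarrow> real ^ 'm \<Rightarrow> real ^ 'n ^ 'n \<Rightarrow> (real ^ 'n) set
     \<Rightarrow> (real ^ 'n) \<times> (real ^ 'm) \<times> (real ^ 'n) \<Rightarrow> bool" where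
  "primal_dual_solution c Q A b D K w \<longleftrightarrow>
     is_arg_min (primal_objective c Q D K) (primal_feasible_point c Q A b D K) (fst w) \<and>
     is_arg_max (dual_objective c Q A b D K) (dual_feasible_point c Q A b D K) w"

section \<open>The algorithm\<close>

definition pmm_residual ::
  "real ^ 'n \<Rightarrow> real ^ 'n ^ 'n \<Rightarrow> real ^ 'n ^ 'm \<Rightarrow> (real ^ 'n) set \<Rightarrow> real \<Rightarrow> real
     \<Rightarrow> real ^ 'n \<Rightarrow> real ^ 'n \<Rightarrow> real ^ 'n \<Rightarrow> real ^ 'm \<Rightarrow> real ^ 'n" where
  "pmm_residual c Q A K \<beta> \<rho> xk zk x y =
     c + Q *v x - transpose A *v y
       + ((zk + \<beta> *\<^sub>R x) - \<beta> *\<^sub>R closest_point K (inverse \<beta> *\<^sub>R zk + x))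
       + inverse \<rho> *\<^sub>R (x - xk)"

definition pmm_operator ::
  "real ^ 'n \<Rightarrow> real ^ 'n ^ 'n \<Rightarrow> real ^ 'n ^ 'm \<Rightarrow> real ^ 'm \<Rightarrow> real ^ 'n ^ 'n \<Rightarrow> (real ^ 'n) set
     \<Rightarrow> real \<Rightarrow> real \<Rightarrow> real ^ 'n \<Rightarrow> real ^ 'm \<Rightarrow> real ^ 'n \<Rightarrow> real ^ 'n \<Rightarrow> real ^ 'm
     \<Rightarrow> ((real ^ 'n) \<times> (real ^ 'm)) set" where
  "pmm_operator c Q A b D K \<beta> \<rho> xk yk zk x y =
     {(u, v). u \<in> (+) (pmm_residual c Q A K \<beta> \<rho> xk zk x y) ` subdifferential (reg D) x \<and>
              v = A *v x + inverse \<beta> *\<^sub>R (y - yk) - b}"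

lemma subdifferential_reg_nonempty: "subdifferential (reg D) x \<noteq> {}"
proof -
  define s where "s = (\<chi> i. sgn ((D *v x) $ i))"
  have "reg D x + (transpose D *v s) \<bullet> (w - x) \<le> reg D w" for w
  proof -
    have *: "(transpose D *v s) \<bullet> (w - x) = s \<bullet> (D *v w) - s \<bullet> (D *v x)"
      by (metis dot_lmul_matrix inner_diff_right matrix_vector_mult_diff_distrib
          transpose_matrix_vector)
    have "s \<bullet> (D *v x) = reg D x"
      unfolding s_def reg_def l1_norm_def inner_vec_def
      by (rule sum.cong) (auto simp: abs_sgn mult.commute)
    moreover have "s \<bullet> (D *v w) \<le> reg D w"
      unfolding s_def reg_def l1_norm_def inner_vec_def
      by (rule sum_mono) (auto simp: sgn_if)
    ultimately show ?thesis using * by simp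
  qed
  then show ?thesis unfolding subdifferential_def by blast
qed

text \<open>\<^const>\<open>infdist\<close> is \<open>0\<close> on the empty set; by the next fact this convention
  never applies in the stopping criterion below. The norm on the product type is the
  Euclidean one.\<close>

lemma pmm_operator_nonempty: "pmm_operator c Q A b D K \<beta> \<rho> xk yk zk x y \<noteq> {}"
  using subdifferential_reg_nonempty[of D x] unfolding pmm_operator_def by auto

text \<open>The algorithm is nondeterministic, since each step only fixes \<open>(x (Suc k), y (Suc k))\<close> up
  to the tolerance; a run is any triple of sequences obeying the recursion.\<close>

definition pd_pmm_run ::
  "real ^ 'n \<Rightarrow> real ^ 'n ^ 'n \<Rightarrow> real ^ 'n ^ 'm \<Rightarrow> real ^ 'm \<Rightarrow> real ^ 'n ^ 'n \<Rightarrow> (real ^ 'n) set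
     \<Rightarrow> (nat \<Rightarrow> real) \<Rightarrow> (nat \<Rightarrow> real) \<Rightarrow> (nat \<Rightarrow> real)
     \<Rightarrow> (nat \<Rightarrow> real ^ 'n) \<Rightarrow> (nat \<Rightarrow> real ^ 'm) \<Rightarrow> (nat \<Rightarrow> real ^ 'n) \<Rightarrow> bool" where
  "pd_pmm_run c Q A b D K \<tau> \<beta> \<epsilon> x y z \<longleftrightarrow>
     (\<forall>k. infdist 0 (pmm_operator c Q A b D K (\<beta> k) (\<beta> k / \<tau> k) (x k) (y k) (z k)
                       (x (Suc k)) (y (Suc k))) \<le> \<epsilon> k \<and>
          z (Suc k) = (z k + \<beta> k *\<^sub>R x (Suc k))
            - \<beta> k *\<^sub>R closest_point K (inverse (\<beta> k) *\<^sub>R z k + x (Suc k)))"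

end

theory Submission
  imports Defs
begin

text \<open>Both problems being feasible, weak duality bounds the nonquadratic part of the primal objective below
  by an affine function of \<open>Q *v x\<close>, and closedness of linear images of polyhedra yields first a primal
  minimizer and then multipliers, that is, a KKT point. The KKT points are the zeros of a maximal
  monotone operator, and a step of the algorithm is an inexact proximal step for it in the metric
  \<open>\<tau> \<bar>x\<bar>\<^sup>2 + \<bar>y\<bar>\<^sup>2 + \<bar>z\<bar>\<^sup>2\<close>. Since \<open>\<tau>\<close> decreases, the iterates are Fejer monotone with respect to
  every KKT point up to the summable errors \<open>4 * \<delta>\<close>. Consecutive iterates therefore approach each other,
  so cluster points are KKT points, and Fejer monotonicity with respect to one cluster point
  forces convergence to it.\<close>

section \<open>Linear images of polyhedra\<close>

text \<open>The obstacle is the lack of compactness and of an interior point: the feasible set may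
  be unbounded, \<open>Q\<close> may be singular, and no Slater condition is available.
  Polyhedrality replaces both. Closed linear images serve once to attain the primal infimum,
  although the minimizing sequence itself may diverge, and once to separate strictly when the
  multipliers are constructed. In a step only the \<open>x\<close> and \<open>y\<close> parts are
  inexact. The new \<open>z\<close> is exactly normal to \<open>K\<close>, but at the projection
  point \<open>p\<close> and not at the new \<open>x\<close>. The gap between these two points is
  the increment of \<open>z\<close> divided by \<beta>, which is just the proximal term of the third
  block. The 4 in the error is 2 * 2: one factor comes from writing inner products as squared
  distances, the other from choosing an element that nearly attains \<open>infdist\<close>. An
  unbounded \<beta> does no harm, because the limit argument only needs its inverse to be
  bounded.\<close>

lemma polyhedron_linear_le:
  fixes f :: "'a::euclidean_space \<Rightarrow> real"
  assumes "linear f"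
  shows "polyhedron {w. f w \<le> r}"
proof -
  have "f w = adjoint f 1 \<bullet> w" for w
    using adjoint_works[OF assms, of w 1] by (simp add: inner_commute)
  then show ?thesis
    using polyhedron_halfspace_le[of "adjoint f 1" r] by simp
qed

lemma polyhedron_all_finite:
  fixes P :: "'i::finite \<Rightarrow> 'a::euclidean_space \<Rightarrow> bool"
  assumes "\<And>i. polyhedron {w. P i w}"
  shows "polyhedron {w. \<forall>i. P i w}"
proof -
  have "{w. \<forall>i. P i w} = (\<Inter>i\<in>UNIV. {w. P i w})"
    by auto
  also have "polyhedron \<dots>"
    using assms by (intro polyhedron_Inter) auto
  finally show ?thesis .
qed

lemma polyhedron_conj:
  assumes "polyhedron {w. P w}" "polyhedron {w. R w}"
  shows "polyhedron {w. P w \<and> R w}"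
  using polyhedron_Int[OF assms] by (simp add: Collect_conj_eq)

text \<open>Among the preimages of each term of a convergent sequence in the image, take one of minimal norm.
  If these were unbounded, they would accumulate at a direction \<open>d\<close> of recession in the kernel,
  and subtracting \<open>d\<close> would stay in the polyhedron and shorten them.\<close>

lemma closed_linear_image_polyhedron:
  fixes L :: "'a::euclidean_space \<Rightarrow> 'b::euclidean_space"
  assumes P: "polyhedron P" and L: "linear L"
  shows "closed (L ` P)"
  unfolding closed_sequential_limits
proof (intro allI impI, elim conjE)
  fix v l assume v: "\<forall>k. v k \<in> L ` P" and lim: "v \<longlonglongrightarrow> l"
  have Lcont: "continuous_on UNIV L"
    using L by (simp add: linear_continuous_on linear_conv_bounded_linear)
  have Ltend: "(\<lambda>k. L (f k)) \<longlonglongrightarrow> L a" if "f \<longlonglongrightarrow> a" for f :: "nat \<Rightarrow> 'a" and a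
    using Lcont that by (metis continuous_on_tendsto_compose UNIV_I eventually_sequentiallyI)
  have "closed P" using P by (rule polyhedron_imp_closed)
  have "\<exists>w. w \<in> P \<and> L w = v k \<and> (\<forall>u. u \<in> P \<and> L u = v k \<longrightarrow> norm w \<le> norm u)" for k
  proof -
    have "closed (P \<inter> L -` {v k})"
      using \<open>closed P\<close> Lcont by (intro closed_Int closed_vimage) auto
    moreover have "P \<inter> L -` {v k} \<noteq> {}" using v[rule_format, of k] by auto
    ultimately obtain w where "w \<in> P \<inter> L -` {v k}" "\<forall>u\<in>P \<inter> L -` {v k}. dist 0 w \<le> dist 0 u"
      by (metis distance_attains_inf)
    then show ?thesis by auto
  qed
  then obtain w where wP: "w k \<in> P" and Lw: "L (w k) = v k"
    and wmin: "\<And>u. u \<in> P \<Longrightarrow> L u = v k \<Longrightarrow> norm (w k) \<le> norm u" for k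
    by metis
  have bdd: "bounded (range w)"
  proof (rule ccontr)
    assume "\<not> bounded (range w)"
    then have "\<forall>n. \<exists>k. real n < norm (w k)"
      unfolding bounded_iff by (metis not_le rangeE)
    then obtain q where q: "\<And>n. real n < norm (w (q n))" by metis
    define e where "e n = w (q n) /\<^sub>R norm (w (q n))" for n
    have en: "norm (e n) = 1" for n
    proof -
      have "norm (w (q n)) > 0" using q[of n] by linarith
      then show ?thesis by (simp add: e_def)
    qed
    then have "\<forall>n. e n \<in> sphere 0 1" by simp
    then obtain d r where d: "norm d = 1" and r: "strict_mono r" and er: "(e \<circ> r) \<longlonglongrightarrow> d"
      using compact_sphere[of "0::'a" 1] unfolding compact_def by (metis mem_sphere_0)
    define u where "u n = w (q (r n))" for n
    have Ninf: "filterlim (\<lambda>n. norm (u n)) at_top sequentially"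
    proof (rule filterlim_at_top_mono[OF filterlim_real_sequentially])
      show "\<forall>\<^sub>F n in sequentially. real n \<le> norm (u n)"
        using q r unfolding u_def
        by (intro always_eventually allI) (meson less_imp_le of_nat_mono order_trans seq_suble)
    qed
    have eu: "(\<lambda>n. u n /\<^sub>R norm (u n)) \<longlonglongrightarrow> d"
      using er by (simp add: e_def u_def comp_def)
    have inner_lim: "(\<lambda>n. (a \<bullet> u n) / norm (u n)) \<longlonglongrightarrow> a \<bullet> d" for a
      using tendsto_inner[OF tendsto_const[of a] eu] by (simp add: divide_inverse_commute)
    have u_eq: "a \<bullet> u n = (a \<bullet> u n) / norm (u n) * norm (u n)" for a n
      by (cases "u n = 0") auto
    have to_top: "filterlim (\<lambda>n. a \<bullet> u n) at_top sequentially" if "a \<bullet> d > 0" for a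
      using filterlim_tendsto_pos_mult_at_top[OF inner_lim that Ninf] by (simp only: u_eq[symmetric])
    have inv0: "(\<lambda>n. inverse (norm (u n))) \<longlonglongrightarrow> 0"
      using Ninf by (rule tendsto_inverse_0_at_top)
    have "L d = 0"
    proof -
      have "(\<lambda>n. L (u n /\<^sub>R norm (u n))) \<longlonglongrightarrow> L d" by (rule Ltend[OF eu])
      moreover have "L (u n /\<^sub>R norm (u n)) = inverse (norm (u n)) *\<^sub>R v (q (r n))" for n
        by (simp add: linear_scale[OF L] u_def Lw)
      moreover have "(\<lambda>n. inverse (norm (u n)) *\<^sub>R v (q (r n))) \<longlonglongrightarrow> 0"
      proof -
        have "bounded (range v)" using lim by (rule convergent_imp_bounded)
        then obtain B where "\<And>k. norm (v k) \<le> B" unfolding bounded_iff by auto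
        then have "Bfun (\<lambda>n. v (q (r n))) sequentially"
          by (intro BfunI[of _ B]) auto
        then have "Zfun (\<lambda>n. inverse (norm (u n)) *\<^sub>R v (q (r n))) sequentially"
          using inv0 by (intro bounded_bilinear.Zfun_prod_Bfun[OF bounded_bilinear_scaleR])
            (auto simp: tendsto_Zfun_iff)
        then show ?thesis by (simp add: tendsto_Zfun_iff)
      qed
      ultimately show ?thesis by (simp add: LIMSEQ_unique)
    qed
    obtain F where F: "finite F" "P = \<Inter>F" and "\<forall>h\<in>F. \<exists>a b. a \<noteq> 0 \<and> h = {x. a \<bullet> x \<le> b}"
      using P unfolding polyhedron_def by blast
    then obtain a b where ab: "\<And>h. h \<in> F \<Longrightarrow> h = {x. a h \<bullet> x \<le> b h}" by metis
    \<comment> \<open>A facet normal is either orthogonal to \<open>d\<close>, so the shift leaves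
      its constraint unchanged, or negative on \<open>d\<close>, so the slack along \<open>u\<close>
      tends to infinity and eventually absorbs the shift. Finitely many facets allow one common
      \<open>n\<close>.\<close>
    have "\<forall>\<^sub>F n in sequentially. u n - d \<in> h" if h: "h \<in> F" for h
    proof -
      have uh: "a h \<bullet> u n \<le> b h" for n
        using wP[of "q (r n)"] F(2) ab[OF h] h unfolding u_def by blast
      have "(\<lambda>n. b h * inverse (norm (u n))) \<longlonglongrightarrow> b h * 0"
        by (intro tendsto_intros inv0)
      then have "a h \<bullet> d \<le> 0"
        using LIMSEQ_le[OF inner_lim[of "a h"]] uh
        by (simp add: divide_inverse) (metis inverse_nonnegative_iff_nonnegative mult_right_mono norm_ge_zero)
      then consider "a h \<bullet> d = 0" | "a h \<bullet> d < 0" by linarith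
      then have "\<forall>\<^sub>F n in sequentially. a h \<bullet> (u n - d) \<le> b h"
      proof cases
        case 1
        then show ?thesis using uh by (simp add: inner_diff_right)
      next
        case 2
        then have "filterlim (\<lambda>n. (- a h) \<bullet> u n) at_top sequentially"
          by (intro to_top) simp
        then have "\<forall>\<^sub>F n in sequentially. - (b h + a h \<bullet> d) \<le> (- a h) \<bullet> u n"
          unfolding filterlim_at_top by blast
        then show ?thesis by (rule eventually_mono) (simp add: inner_diff_right)
      qed
      then show ?thesis using ab[OF h] by (metis (mono_tags, lifting) eventually_mono mem_Collect_eq)
    qed
    then have "\<forall>\<^sub>F n in sequentially. u n - d \<in> P"
      using F by (simp add: eventually_ball_finite)
    moreover have "\<forall>\<^sub>F n in sequentially. 1 \<le> d \<bullet> u n"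
      using to_top[of d] d unfolding filterlim_at_top by (metis dot_square_norm one_power2 zero_less_one)
    ultimately have "\<forall>\<^sub>F n in sequentially. u n - d \<in> P \<and> 1 \<le> d \<bullet> u n"
      by (rule eventually_conj)
    then obtain n where n: "u n - d \<in> P" "1 \<le> d \<bullet> u n"
      using eventually_happens by force
    have "norm (u n) \<le> norm (u n - d)"
      using n(1) wmin[of "u n - d" "q (r n)"] linear_diff[OF L, of "u n" d] \<open>L d = 0\<close> Lw
      unfolding u_def by auto
    \<comment> \<open>Expanding with \<open>norm d = 1\<close> gives
      \<open>(norm (u n))\<^sup>2 - 2 * (d \<bullet> u n) + 1\<close>, strictly smaller than
      \<open>(norm (u n))\<^sup>2\<close> once \<open>d \<bullet> u n\<close> is at least 1.\<close>
    then have "(norm (u n))\<^sup>2 \<le> (norm (u n - d))\<^sup>2" by simp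
    then show False
      using n(2) d unfolding power2_norm_eq_inner
      by (simp add: inner_diff_left inner_diff_right inner_commute norm_eq_1)
  qed
  obtain a s where s: "strict_mono s" and ws: "(w \<circ> s) \<longlonglongrightarrow> a"
    using bounded_imp_convergent_subsequence[OF bdd] by blast
  have "a \<in> P" by (rule closed_sequentially[OF \<open>closed P\<close> _ ws]) (simp add: wP)
  moreover have "L a = l"
  proof (rule LIMSEQ_unique)
    show "(v \<circ> s) \<longlonglongrightarrow> L a" using Ltend[OF ws] by (simp add: Lw comp_def)
    show "(v \<circ> s) \<longlonglongrightarrow> l" using lim s by (rule LIMSEQ_subseq_LIMSEQ)
  qed
  ultimately show "l \<in> L ` P" by blast
qed

lemma polyhedron_linear_vimage:
  fixes f :: "'a::euclidean_space \<Rightarrow> 'b::euclidean_space"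
  assumes f: "linear f" and P: "polyhedron P"
  shows "polyhedron {w. f w \<in> P}"
proof -
  obtain F where F: "finite F" "P = \<Inter>F" "\<forall>h\<in>F. \<exists>a b. a \<noteq> 0 \<and> h = {x. a \<bullet> x \<le> b}"
    using P unfolding polyhedron_def by blast
  have "polyhedron {w. f w \<in> h}" if h: "h \<in> F" for h
  proof -
    obtain a b where "h = {x. a \<bullet> x \<le> b}" using F(3) h by blast
    moreover have "linear (\<lambda>w. a \<bullet> f w)"
      by (intro linearI) (simp_all add: linear_add[OF f] linear_scale[OF f] inner_add_right)
    ultimately show ?thesis using polyhedron_linear_le by simp
  qed
  then have "polyhedron (\<Inter>h\<in>F. {w. f w \<in> h})"
    using F(1) by (intro polyhedron_Inter) auto
  moreover have "{w. f w \<in> P} = (\<Inter>h\<in>F. {w. f w \<in> h})"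
    unfolding F(2) by auto
  ultimately show ?thesis by simp
qed

lemma polyhedron_box_set: "polyhedron (box_set lo hi)"
proof -
  have lin: "linear (\<lambda>x::real^'n. x $ i)" "linear (\<lambda>x::real^'n. - (x $ i))" for i
    by (auto intro!: linearI)
  \<comment> \<open>An infinite entry yields the whole space or the empty set; only a real one
    yields a halfspace.\<close>
  have "polyhedron {x::real^'n. l \<le> ereal (x $ i)}" for l i
    using polyhedron_linear_le[OF lin(2), of i "- real_of_ereal l"] by (cases l) auto
  moreover have "polyhedron {x::real^'n. ereal (x $ i) \<le> l}" for l i
    using polyhedron_linear_le[OF lin(1), of i] by (cases l) auto
  ultimately show ?thesis
    unfolding box_set_def by (intro polyhedron_all_finite polyhedron_conj)
qed

section \<open>Duality and the KKT conditions\<close>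

lemma transpose_vector_inner: "(transpose A *v y) \<bullet> x = y \<bullet> (A *v x)" for A :: "real ^ 'n ^ 'm"
  by (metis dot_lmul_matrix transpose_matrix_vector)

section \<open>Positive semidefinite quadratic forms\<close>

lemma psd_inner_commute: "psd Q \<Longrightarrow> (Q *v x) \<bullet> y = x \<bullet> (Q *v y)"
  using transpose_vector_inner[of Q x y] by (simp add: psd_def)

lemma psd_nonneg: "psd Q \<Longrightarrow> 0 \<le> x \<bullet> (Q *v x)"
  by (simp add: psd_def)

lemma psd_diff_square:
  assumes "psd Q"
  shows "(u - x) \<bullet> (Q *v (u - x)) = u \<bullet> (Q *v u) - 2 * (u \<bullet> (Q *v x)) + x \<bullet> (Q *v x)"
  using psd_inner_commute[OF assms, of x u]
  by (simp add: matrix_vector_mult_diff_distrib inner_diff_left inner_diff_right inner_commute)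

text \<open>Convexity of the quadratic form: its tangent at \<open>x\<close> lies below it. The
  tangent depends on \<open>u\<close> only through \<open>Q *v u\<close>, which matters where
  \<open>Q *v u\<close> converges but \<open>u\<close> need not.\<close>

lemma psd_tangent_le:
  assumes "psd Q"
  shows "x \<bullet> (Q *v u) - 1/2 * (x \<bullet> (Q *v x)) \<le> 1/2 * (u \<bullet> (Q *v u))"
  using psd_nonneg[OF assms, of "u - x"] psd_diff_square[OF assms, of u x]
    psd_inner_commute[OF assms, of x u]
  by (simp add: inner_commute)

lemma psd_Cauchy_Schwarz:
  assumes "psd Q"
  shows "(h \<bullet> (Q *v v))\<^sup>2 \<le> (h \<bullet> (Q *v h)) * (v \<bullet> (Q *v v))"
proof -
  define a where "a = v \<bullet> (Q *v v)"
  define p where "p = h \<bullet> (Q *v v)"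
  define q where "q = h \<bullet> (Q *v h)"
  have quad: "0 \<le> q - 2 * t * p + t\<^sup>2 * a" for t
    using psd_nonneg[OF assms, of "h - t *\<^sub>R v"] psd_diff_square[OF assms, of h "t *\<^sub>R v"]
      psd_inner_commute[OF assms, of h v]
    by (simp add: inner_commute a_def p_def q_def matrix_vector_mult_scaleR power2_eq_square algebra_simps)
  have "a \<ge> 0" using psd_nonneg[OF assms] by (simp add: a_def)
  show ?thesis
  proof (cases "a = 0")
    case True
    \<comment> \<open>For \<open>a = 0\<close> the expression in \<open>quad\<close> is affine in
      \<open>t\<close>, and the \<open>t\<close> chosen here would give it the value -1.\<close>
    have "p = 0"
    proof (rule ccontr)
      assume "p \<noteq> 0"
      then show False using quad[of "(q + 1) / (2 * p)"] True by simp
    qed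
    then show ?thesis using True by (simp add: a_def p_def)
  next
    case False
    then have "a > 0" using \<open>a \<ge> 0\<close> by simp
    then have "0 \<le> q - p\<^sup>2 / a"
      using quad[of "p / a"] by (simp add: power2_eq_square)
    then have "p\<^sup>2 \<le> q * a" using \<open>a > 0\<close> by (simp add: field_simps)
    then show ?thesis by (simp add: a_def p_def q_def)
  qed
qed

text \<open>Cauchy-Schwarz for the form, applied to \<open>h\<close> and \<open>v = Q *v h\<close>,
  has \<open>(norm v)\<^sup>2\<close> as its mixed term, and one such factor cancels. Hence a bound
  on the form controls \<open>Q *v h\<close> even if \<open>Q\<close> is singular and
  \<open>h\<close> is unbounded.\<close>

lemma psd_norm_square_le:
  assumes "psd Q"
  shows "\<exists>M\<ge>0. \<forall>h. (norm (Q *v h))\<^sup>2 \<le> M * (h \<bullet> (Q *v h))"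
proof -
  obtain M where M: "\<And>v. norm (Q *v v) \<le> norm v * M"
    using bounded_linear.nonneg_bounded[OF matrix_vector_mul_bounded_linear[of Q]] by blast
  have "(norm (Q *v h))\<^sup>2 \<le> \<bar>M\<bar> * (h \<bullet> (Q *v h))" for h
  proof -
    define v where "v = Q *v h"
    have "v \<bullet> (Q *v v) \<le> norm v * norm (Q *v v)" by (rule norm_cauchy_schwarz)
    also have "\<dots> \<le> norm v * (norm v * \<bar>M\<bar>)"
      by (intro mult_left_mono order_trans[OF M[of v]]) auto
    finally have 1: "v \<bullet> (Q *v v) \<le> (norm v)\<^sup>2 * \<bar>M\<bar>" by (simp add: power2_eq_square)
    have "h \<bullet> (Q *v v) = (norm v)\<^sup>2"
      using psd_inner_commute[OF assms, of h v] by (simp add: v_def power2_norm_eq_inner)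
    then have "((norm v)\<^sup>2)\<^sup>2 \<le> (h \<bullet> (Q *v h)) * (v \<bullet> (Q *v v))"
      using psd_Cauchy_Schwarz[OF assms, of h v] by simp
    also have "\<dots> \<le> (h \<bullet> (Q *v h)) * ((norm v)\<^sup>2 * \<bar>M\<bar>)"
      using 1 psd_nonneg[OF assms] by (intro mult_left_mono) auto
    finally have "(norm v)\<^sup>2 * (norm v)\<^sup>2 \<le> (norm v)\<^sup>2 * (\<bar>M\<bar> * (h \<bullet> (Q *v h)))"
      by (simp add: power2_eq_square mult_ac)
    then have "(norm v)\<^sup>2 \<le> \<bar>M\<bar> * (h \<bullet> (Q *v h))" if "v \<noteq> 0"
      by (rule mult_left_le_imp_le) (simp add: that)
    then have "(norm v)\<^sup>2 \<le> \<bar>M\<bar> * (h \<bullet> (Q *v h))"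
      using psd_nonneg[OF assms, of h] by (cases "v = 0") simp_all
    then show ?thesis by (simp add: v_def)
  qed
  then show ?thesis by (metis abs_ge_zero)
qed

text \<open>The inequality for \<open>z\<close> says that \<open>z\<close> lies in the normal cone
  of \<open>K\<close> at \<open>x\<close>. Variational inequalities are used instead of conjugates
  because they pass to limits directly.\<close>

definition kkt_point ::
  "real ^ 'n \<Rightarrow> real ^ 'n ^ 'n \<Rightarrow> real ^ 'n ^ 'm \<Rightarrow> real ^ 'm \<Rightarrow> real ^ 'n ^ 'n \<Rightarrow> (real ^ 'n) set
     \<Rightarrow> (real ^ 'n) \<times> (real ^ 'm) \<times> (real ^ 'n) \<Rightarrow> bool" where
  "kkt_point c Q A b D K = (\<lambda>(x, y, z). A *v x = b \<and> x \<in> K \<and> (\<forall>u\<in>K. z \<bullet> (u - x) \<le> 0) \<and>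
     transpose A *v y - c - Q *v x - z \<in> subdifferential (reg D) x)"

section \<open>Fenchel duality and optimality\<close>

lemma primal_objective_in: "u \<in> K \<Longrightarrow>
    primal_objective c Q D K u = ereal (c \<bullet> u + 1/2 * (u \<bullet> (Q *v u)) + reg D u)"
  by (simp add: primal_objective_def convex_indicator_def)

lemma primal_feasible_point_iff: "primal_feasible_point c Q A b D K u \<longleftrightarrow> A *v u = b \<and> u \<in> K"
  by (simp add: primal_feasible_point_def primal_objective_def convex_indicator_def)

lemma conjugate_indicator_ge: "u \<in> K \<Longrightarrow> ereal (z \<bullet> u) \<le> fenchel_conjugate (convex_indicator K) z"
  unfolding fenchel_conjugate_def
  by (rule SUP_upper2[of u]) (simp_all add: convex_indicator_def)

lemma conjugate_real_ge: "ereal (s \<bullet> u - f u) \<le> fenchel_conjugate (\<lambda>x. ereal (f x)) s"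
  unfolding fenchel_conjugate_def by (rule SUP_upper2[of u]) simp_all

lemma conjugate_indicator_normal:
  assumes "u \<in> K" "\<forall>v\<in>K. z \<bullet> (v - u) \<le> 0"
  shows "fenchel_conjugate (convex_indicator K) z = ereal (z \<bullet> u)"
proof (rule antisym[OF _ conjugate_indicator_ge[OF assms(1)]])
  show "fenchel_conjugate (convex_indicator K) z \<le> ereal (z \<bullet> u)"
    unfolding fenchel_conjugate_def using assms(2)
    by (intro SUP_least) (auto simp: convex_indicator_def inner_diff_right)
qed

lemma conjugate_real_subgradient:
  assumes "s \<in> subdifferential f u"
  shows "fenchel_conjugate (\<lambda>x. ereal (f x)) s = ereal (s \<bullet> u - f u)"
proof (rule antisym[OF _ conjugate_real_ge])
  have "s \<bullet> v - f v \<le> s \<bullet> u - f u" for v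
    using assms unfolding subdifferential_def by (auto simp: inner_diff_right algebra_simps)
  then show "fenchel_conjugate (\<lambda>x. ereal (f x)) s \<le> ereal (s \<bullet> u - f u)"
    unfolding fenchel_conjugate_def by (intro SUP_least) simp
qed

text \<open>Both conjugates are bounded below by their Fenchel inequality at the same
  \<open>u\<close>; the quadratic terms that remain are compared by the tangent inequality.\<close>

lemma weak_duality:
  assumes "psd Q" "u \<in> K" "A *v u = b"
  shows "dual_objective c Q A b D K w \<le> primal_objective c Q D K u"
proof -
  obtain x y z where w: "w = (x, y, z)" by (cases w)
  define s where "s = transpose A *v y - c - Q *v x - z"
  have *: "ereal r - a - e \<le> ereal (r - p - q)" if "ereal p \<le> a" "ereal q \<le> e" for r p q :: real and a e
    using that by (cases a; cases e) auto
  have "dual_objective c Q A b D K w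
      \<le> ereal (b \<bullet> y - 1/2 * (x \<bullet> (Q *v x)) - z \<bullet> u - (s \<bullet> u - reg D u))"
    unfolding dual_objective_def w s_def prod.case
    by (intro * conjugate_indicator_ge conjugate_real_ge assms)
  also have "s \<bullet> u = b \<bullet> y - c \<bullet> u - u \<bullet> (Q *v x) - z \<bullet> u"
    by (simp add: s_def inner_diff_left dot_lmul_matrix assms(3))
      (simp add: inner_commute)
  also have "b \<bullet> y - 1/2 * (x \<bullet> (Q *v x)) - z \<bullet> u - (b \<bullet> y - c \<bullet> u - u \<bullet> (Q *v x) - z \<bullet> u - reg D u)
      \<le> c \<bullet> u + 1/2 * (u \<bullet> (Q *v u)) + reg D u"
    using psd_tangent_le[OF assms(1), of x u] psd_inner_commute[OF assms(1), of x u]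
    by (simp add: inner_commute)
  finally show ?thesis by (simp add: primal_objective_in[OF assms(2)])
qed

text \<open>Normality of \<open>z\<close> and the subgradient condition turn the two Fenchel
  inequalities into equalities, and the quadratic parts agree because primal and dual share
  \<open>x\<close>.\<close>

lemma kkt_point_strong_duality:
  assumes "kkt_point c Q A b D K (x, y, z)"
  shows "dual_objective c Q A b D K (x, y, z) = primal_objective c Q D K x"
proof -
  let ?s = "transpose A *v y - c - Q *v x - z"
  have k: "A *v x = b" "x \<in> K" "\<forall>u\<in>K. z \<bullet> (u - x) \<le> 0" "?s \<in> subdifferential (reg D) x"
    using assms by (auto simp: kkt_point_def)
  show ?thesis
    unfolding dual_objective_def prod.case conjugate_indicator_normal[OF k(2,3)]
      conjugate_real_subgradient[OF k(4)] primal_objective_in[OF k(2)]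
    using k(1) by (simp add: inner_diff_left dot_lmul_matrix) (simp add: inner_commute algebra_simps)
qed

lemma kkt_point_imp_primal_dual_solution:
  assumes "psd Q" "kkt_point c Q A b D K w"
  shows "primal_dual_solution c Q A b D K w"
proof -
  obtain x y z where w: "w = (x, y, z)" by (cases w)
  have eq: "dual_objective c Q A b D K w = primal_objective c Q D K x"
    using kkt_point_strong_duality assms(2) unfolding w by blast
  have x: "A *v x = b" "x \<in> K" using assms(2) by (auto simp: w kkt_point_def)
  have "is_arg_min (primal_objective c Q D K) (primal_feasible_point c Q A b D K) x"
    using x weak_duality[OF assms(1), of _ K A b c D w] eq
    unfolding is_arg_min_def primal_feasible_point_iff by (metis not_le)
  moreover have "is_arg_max (dual_objective c Q A b D K) (dual_feasible_point c Q A b D K) w"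
    using weak_duality[OF assms(1) x(2,1), of c D] eq primal_objective_in[OF x(2), of c Q D]
    unfolding is_arg_max_def dual_feasible_point_def by (auto simp: not_less)
  ultimately show ?thesis by (simp add: primal_dual_solution_def w)
qed

section \<open>Existence of a primal minimizer\<close>

lemma continuous_reg: "continuous_on UNIV (reg D)"
  unfolding reg_def l1_norm_def
  by (intro continuous_intros continuous_on_rabs continuous_on_component
      linear_continuous_on matrix_vector_mul_bounded_linear)

text \<open>The vector \<open>t\<close> in the polyhedron below majorizes the absolute values that make up the
  regularizer. Only \<open>Q *v u\<close> and the value of the remaining objective are controlled along a
  minimizing sequence, which is why closedness of a linear image is needed.\<close>

lemma primal_minimizer_exists:
  fixes Q D :: "real ^ 'n ^ 'n" and A :: "real ^ 'n ^ 'm"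
  assumes Q: "psd Q" and K: "K = box_set al au"
    and feas: "A *v u0 = b" "u0 \<in> K"
    and low: "\<And>u. u \<in> K \<Longrightarrow> A *v u = b \<Longrightarrow> C - p \<bullet> (Q *v u) \<le> c \<bullet> u + reg D u"
  shows "\<exists>x\<in>K. A *v x = b \<and> (\<forall>u\<in>K. A *v u = b \<longrightarrow>
    c \<bullet> x + 1/2 * (x \<bullet> (Q *v x)) + reg D x \<le> c \<bullet> u + 1/2 * (u \<bullet> (Q *v u)) + reg D u)"
proof -
  define q where "q u = c \<bullet> u + 1/2 * (u \<bullet> (Q *v u)) + reg D u" for u
  define F where "F = {u\<in>K. A *v u = b}"
  define P where "P = {w::(real^'n) \<times> (real^'n). fst w \<in> box_set al au \<and>
    (\<forall>i. (A *v fst w) $ i \<le> b $ i \<and> - (A *v fst w) $ i \<le> - b $ i) \<and>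
    (\<forall>i. (D *v fst w) $ i - snd w $ i \<le> 0 \<and> - (D *v fst w) $ i - snd w $ i \<le> 0)}"
  define L where "L w = (Q *v fst w, c \<bullet> fst w + (\<Sum>i\<in>UNIV. snd w $ i))" for w :: "(real^'n) \<times> (real^'n)"
  have linL: "linear L"
    unfolding L_def
    by (intro linearI) (auto simp: matrix_vector_right_distrib inner_add_right sum.distrib
        matrix_vector_mult_scaleR sum_distrib_left algebra_simps)
  have "polyhedron P"
  proof -
    have box: "polyhedron {w::(real^'n) \<times> (real^'n). fst w \<in> box_set al au}"
      by (rule polyhedron_linear_vimage[OF linear_fst polyhedron_box_set])
    show ?thesis
      unfolding P_def
      by (intro polyhedron_conj polyhedron_all_finite box polyhedron_linear_le)
        (auto intro!: linearI simp: matrix_vector_right_distrib matrix_vector_mult_scaleR algebra_simps)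
  qed
  then have closedL: "closed (L ` P)" using linL by (rule closed_linear_image_polyhedron)
  have FP: "L (u, \<chi> i. \<bar>(D *v u) $ i\<bar>) = (Q *v u, c \<bullet> u + reg D u)"
    "(u, \<chi> i. \<bar>(D *v u) $ i\<bar>) \<in> P" if "u \<in> F" for u
    using that by (auto simp: L_def P_def F_def K box_set_def reg_def l1_norm_def abs_le_iff)
  have PF: "fst w \<in> F \<and> reg D (fst w) \<le> (\<Sum>i\<in>UNIV. snd w $ i)" if "w \<in> P" for w
    using that unfolding P_def F_def K box_set_def reg_def l1_norm_def
    by (auto simp: vec_eq_iff abs_le_iff intro!: sum_mono antisym)
  \<comment> \<open>Completing the square in \<open>low\<close> after adding the quadratic term. A
    bound on \<open>q u\<close> thus bounds the form at \<open>u - p\<close>, hence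
    \<open>Q *v u\<close>, without bounding \<open>u\<close>.\<close>
  have qlow: "C - 1/2 * (p \<bullet> (Q *v p)) + 1/2 * ((u - p) \<bullet> (Q *v (u - p))) \<le> q u" if "u \<in> F" for u
    using low[of u] that psd_diff_square[OF Q, of u p] psd_inner_commute[OF Q, of u p]
    by (simp add: F_def q_def inner_commute add_divide_distrib diff_divide_distrib)
  then have qlow': "C - 1/2 * (p \<bullet> (Q *v p)) \<le> q u" if "u \<in> F" for u
    using that psd_nonneg[OF Q, of "u - p"] by force
  define I where "I = Inf (q ` F)"
  have ne: "F \<noteq> {}" using feas by (auto simp: F_def)
  have bdd: "bdd_below (q ` F)" using qlow' by (auto intro!: bdd_belowI)
  have "\<exists>u\<in>F. q u < I + inverse (Suc n)" for n
    using cInf_less_iff[of "q ` F" "I + inverse (Suc n)"] ne bdd by (auto simp: I_def)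
  then obtain u where uF: "\<And>n. u n \<in> F" and uq: "\<And>n. q (u n) < I + inverse (Suc n)" by metis
  have uq1: "q (u n) \<le> I + 1" for n
    using uq[of n] by (smt (verit) inverse_Suc le_less_trans inverse_le_1_iff of_nat_Suc of_nat_0_le_iff)
  have bddQ: "bounded (range (\<lambda>n. Q *v u n))"
  proof -
    obtain M where M: "M \<ge> 0" "\<And>h. (norm (Q *v h))\<^sup>2 \<le> M * (h \<bullet> (Q *v h))"
      using psd_norm_square_le[OF Q] by blast
    define R where "R = M * (2 * (I + 1 - C + 1/2 * (p \<bullet> (Q *v p))))"
    have "norm (Q *v u n) \<le> norm (Q *v p) + sqrt R" for n
    proof -
      have "(u n - p) \<bullet> (Q *v (u n - p)) \<le> 2 * (I + 1 - C + 1/2 * (p \<bullet> (Q *v p)))"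
        using qlow[OF uF[of n]] uq1[of n] by (simp add: field_simps)
      then have "(norm (Q *v (u n - p)))\<^sup>2 \<le> R"
        unfolding R_def using M by (meson mult_left_mono order_trans)
      then have "norm (Q *v (u n - p)) \<le> sqrt R" by (rule real_le_rsqrt)
      then show ?thesis
        using norm_triangle_sub[of "Q *v u n" "Q *v p"]
        by (simp add: matrix_vector_mult_diff_distrib)
    qed
    then show ?thesis unfolding bounded_iff by blast
  qed
  define s where "s n = c \<bullet> u n + reg D (u n)" for n
  have bdds: "bounded (range s)"
  proof -
    obtain B where B: "\<And>n. norm (Q *v u n) \<le> B" using bddQ unfolding bounded_iff by auto
    have "C - norm p * B \<le> s n" for n
    proof -
      have "p \<bullet> (Q *v u n) \<le> norm p * norm (Q *v u n)" by (rule norm_cauchy_schwarz)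
      also have "\<dots> \<le> norm p * B" using B by (intro mult_left_mono) auto
      finally show ?thesis using low[of "u n"] uF[of n] by (simp add: s_def F_def)
    qed
    moreover have "s n \<le> I + 1" for n
      using uq1[of n] psd_nonneg[OF Q, of "u n"] by (simp add: s_def q_def)
    ultimately have "range s \<subseteq> {C - norm p * B .. I + 1}" by auto
    then show ?thesis using bounded_closed_interval bounded_subset by blast
  qed
  have "bounded (range (\<lambda>n. (Q *v u n, s n)))"
    using bounded_Times[OF bddQ bdds] by (rule bounded_subset) auto
  then obtain l r where r: "strict_mono r" and lim: "((\<lambda>n. (Q *v u n, s n)) \<circ> r) \<longlonglongrightarrow> l"
    using bounded_imp_convergent_subsequence by blast
  have "l \<in> L ` P"
  proof (rule closed_sequentially[OF closedL _ lim])
    show "((\<lambda>n. (Q *v u n, s n)) \<circ> r) n \<in> L ` P" for n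
      using FP[OF uF] by (auto simp: s_def image_iff intro!: bexI)
  qed
  then obtain w where w: "w \<in> P" "l = L w" by blast
  define x where "x = fst w"
  have x: "x \<in> F" "c \<bullet> x + reg D x \<le> snd l" "fst l = Q *v x"
    using PF[OF w(1)] w(2) by (auto simp: x_def L_def)
  \<comment> \<open>The minimizing sequence need not converge to \<open>x\<close>, so continuity of
    \<open>q\<close> is of no help. The quadratic part is replaced by its tangent at
    \<open>x\<close>, whose limit is known because \<open>Q *v u (r n)\<close> tends to
    \<open>Q *v x\<close>.\<close>
  have "q x \<le> I"
  proof -
    have 1: "(\<lambda>n. x \<bullet> (Q *v u (r n)) - 1/2 * (x \<bullet> (Q *v x)) + s (r n)) \<longlonglongrightarrow>
        x \<bullet> (Q *v x) - 1/2 * (x \<bullet> (Q *v x)) + snd l"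
      using tendsto_fst[OF lim] tendsto_snd[OF lim] unfolding x(3)
      by (intro tendsto_intros) (simp_all add: comp_def)
    have 2: "(\<lambda>n. I + inverse (Suc (r n))) \<longlonglongrightarrow> I + 0"
      using LIMSEQ_subseq_LIMSEQ[OF LIMSEQ_inverse_real_of_nat r]
      by (intro tendsto_intros) (simp add: comp_def)
    have "x \<bullet> (Q *v u n) - 1/2 * (x \<bullet> (Q *v x)) + s n \<le> I + inverse (Suc n)" for n
      using psd_tangent_le[OF Q, of x "u n"] uq[of n] by (simp add: s_def q_def)
    then have "x \<bullet> (Q *v x) - 1/2 * (x \<bullet> (Q *v x)) + snd l \<le> I + 0"
      by (intro LIMSEQ_le[OF 1 2]) blast
    then show ?thesis using x(2) by (simp add: q_def)
  qed
  moreover have "I \<le> q v" if "v \<in> F" for v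
    using that bdd by (auto simp: I_def intro: cInf_lower)
  ultimately show ?thesis
    using x(1) unfolding F_def q_def by (intro bexI[of _ x]) (auto intro: order_trans)
qed

section \<open>Subgradients of the regularizer and existence of multipliers\<close>

lemma diagonal_mult: "diagonal D \<Longrightarrow> (D *v u) $ i = D $ i $ i * u $ i"
  unfolding matrix_vector_mult_def diagonal_def
  by (simp add: sum.remove[of UNIV i])

lemma psd_diagonal_entry_nonneg: "psd D \<Longrightarrow> 0 \<le> D $ i $ i"
  using psd_nonneg[of D "axis i 1"]
  by (simp add: inner_axis' matrix_vector_mult_basis column_def)

lemma reg_diagonal:
  assumes "diagonal D" "psd D"
  shows "reg D u = (\<Sum>i\<in>UNIV. D $ i $ i * \<bar>u $ i\<bar>)"
  unfolding reg_def l1_norm_def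
  by (simp add: diagonal_mult[OF assms(1)] abs_mult psd_diagonal_entry_nonneg[OF assms(2)])

text \<open>Diagonality decouples the coordinates. The two bounds coincide at
  \<open>D $ i $ i * sgn (x $ i)\<close> if \<open>x $ i\<close> is nonzero, and at zero they leave
  the full interval from \<open>- D $ i $ i\<close> to \<open>D $ i $ i\<close>.\<close>

lemma subdifferential_reg_diagonalI:
  assumes D: "diagonal D" "psd D"
    and s: "\<And>i. (if x $ i > 0 then D $ i $ i else - (D $ i $ i)) \<le> s $ i"
      "\<And>i. s $ i \<le> (if x $ i \<ge> 0 then D $ i $ i else - (D $ i $ i))"
  shows "s \<in> subdifferential (reg D) x"
proof -
  have "reg D x + s \<bullet> (w - x) \<le> reg D w" for w
  proof -
    have "D $ i $ i * \<bar>x $ i\<bar> + s $ i * (w $ i - x $ i) \<le> D $ i $ i * \<bar>w $ i\<bar>" for i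
    proof -
      have d: "0 \<le> D $ i $ i" using D(2) by (rule psd_diagonal_entry_nonneg)
      have "\<bar>s $ i\<bar> \<le> D $ i $ i" using s[of i] d by (auto split: if_splits)
      then have "s $ i * w $ i \<le> D $ i $ i * \<bar>w $ i\<bar>"
        using abs_ge_self[of "s $ i * w $ i"] mult_right_mono[of "\<bar>s $ i\<bar>" "D $ i $ i" "\<bar>w $ i\<bar>"]
        by (simp add: abs_mult)
      moreover have "s $ i * x $ i = D $ i $ i * \<bar>x $ i\<bar>"
        using s[of i] d by (cases "x $ i" "0::real" rule: linorder_cases) auto
      ultimately show ?thesis by (simp add: right_diff_distrib)
    qed
    then have "(\<Sum>i\<in>UNIV. D $ i $ i * \<bar>x $ i\<bar> + s $ i * (w $ i - x $ i)) \<le> (\<Sum>i\<in>UNIV. D $ i $ i * \<bar>w $ i\<bar>)"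
      by (rule sum_mono)
    then show ?thesis
      by (simp add: reg_diagonal[OF D] inner_vec_def sum.distrib)
  qed
  then show ?thesis by (simp add: subdifferential_def)
qed

text \<open>The set \<open>B\<close> is the sum of the normal cone of \<open>K\<close> and the subdifferential of the regularizer
  at \<open>x\<close>; both are products of intervals. Its image under \<open>(y, v) \<mapsto> transpose A *v y - v\<close> is closed,
  and a hyperplane separating \<open>c + Q *v x\<close> from that image would give a feasible descent direction.\<close>

lemma multipliers_exist:
  fixes Q D :: "real ^ 'n ^ 'n" and A :: "real ^ 'n ^ 'm"
  assumes Q: "psd Q" and D: "diagonal D" "psd D" and K: "K = box_set al au"
    and x: "A *v x = b" "x \<in> K"
    and min: "\<And>u. u \<in> K \<Longrightarrow> A *v u = b \<Longrightarrow>
      c \<bullet> x + 1/2 * (x \<bullet> (Q *v x)) + reg D x \<le> c \<bullet> u + 1/2 * (u \<bullet> (Q *v u)) + reg D u"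
  shows "\<exists>y z. kkt_point c Q A b D K (x, y, z)"
proof -
  define d where "d i = D $ i $ i" for i
  have d: "0 \<le> d i" for i unfolding d_def using D(2) by (rule psd_diagonal_entry_nonneg)
  define lo where "lo i = (if x $ i > 0 then d i else - d i)" for i
  define hi where "hi i = (if x $ i \<ge> 0 then d i else - d i)" for i
  have lohi: "lo i \<le> hi i" for i using d[of i] by (auto simp: lo_def hi_def)
  have sub: "s \<in> subdifferential (reg D) x" if "\<And>i. lo i \<le> s $ i" "\<And>i. s $ i \<le> hi i" for s
    using that unfolding lo_def hi_def d_def by (intro subdifferential_reg_diagonalI[OF D])
  \<comment> \<open>At an active bound the normal cone of \<open>K\<close> contributes a half-line,
    so the endpoint on that side is released to infinity.\<close>
  define B where "B = box_set (\<chi> i. if al $ i = ereal (x $ i) then - \<infinity> else ereal (lo i))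
    (\<chi> i. if au $ i = ereal (x $ i) then \<infinity> else ereal (hi i))"
  have B: "v \<in> B \<longleftrightarrow> (\<forall>i. (al $ i = ereal (x $ i) \<or> lo i \<le> v $ i) \<and> (au $ i = ereal (x $ i) \<or> v $ i \<le> hi i))" for v
    by (auto simp: B_def box_set_def)
  define g where "g = (\<lambda>(y, v). transpose A *v y - v)"
  define S where "S = g ` {w. snd w \<in> B}"
  have lin: "linear g"
    unfolding g_def case_prod_beta by (intro linearI) (simp_all add: matrix_vector_right_distrib matrix_vector_mult_scaleR algebra_simps)
  have poly: "polyhedron {w::(real^'m) \<times> (real^'n). snd w \<in> B}"
    unfolding B_def by (intro polyhedron_linear_vimage polyhedron_box_set linear_snd)
  have "closed S" unfolding S_def using poly lin by (rule closed_linear_image_polyhedron)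
  have "convex S" unfolding S_def using polyhedron_imp_convex[OF poly] lin by (rule convex_linear_image[rotated])
  have "c + Q *v x \<in> S"
  proof (rule ccontr)
    assume "c + Q *v x \<notin> S"
    then obtain a \<eta> where a: "a \<bullet> (c + Q *v x) < \<eta>" and aS: "\<And>w. w \<in> S \<Longrightarrow> \<eta> < a \<bullet> w"
      using separating_hyperplane_closed_point[OF \<open>convex S\<close> \<open>closed S\<close>] by blast
    have aB: "\<eta> < (A *v a) \<bullet> y - a \<bullet> v" if "v \<in> B" for y v
    proof -
      have "g (y, v) \<in> S" using that unfolding S_def by auto
      from aS[OF this] show ?thesis
        using transpose_vector_inner[of A y a]
        by (simp add: g_def inner_diff_right inner_commute del: transpose_matrix_vector)
    qed
    \<comment> \<open>The subgradient realizing the directional derivative of the regularizer along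
      \<open>a\<close>: at a zero of \<open>x\<close> the sign is taken from \<open>a\<close>. Hence
      the regularizer equals the inner product with \<open>s\<close> on a short segment from
      \<open>x\<close> in direction \<open>a\<close>.\<close>
    define s where "s = (\<chi> i. d i * (if x $ i = 0 then sgn (a $ i) else sgn (x $ i)))"
    have s: "lo i \<le> s $ i" "s $ i \<le> hi i" for i
      using d[of i] by (auto simp: s_def lo_def hi_def sgn_if)
    have sB: "s \<in> B" using s B by blast
    \<comment> \<open>The multiplier \<open>y\<close> ranges over a whole space, so a nonzero
      \<open>A *v a\<close> would let the left side of the separation inequality equal
      \<eta>.\<close>
    have Aa: "A *v a = 0"
    proof (rule ccontr)
      assume "A *v a \<noteq> 0"
      then show False
        using aB[OF sB, of "((\<eta> + a \<bullet> s) / ((A *v a) \<bullet> (A *v a))) *\<^sub>R (A *v a)"] by simp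
    qed
    then have aB': "a \<bullet> v < - \<eta>" if "v \<in> B" for v
      using aB[OF that, of 0] by simp
    have tangent: "a $ i \<ge> 0 \<or> al $ i \<noteq> ereal (x $ i)" "a $ i \<le> 0 \<or> au $ i \<noteq> ereal (x $ i)" for i
    proof -
      \<comment> \<open>Chosen so that \<open>a \<bullet> (s + axis i t)\<close> is exactly
        \<open>- \<eta>\<close>, violating the strict bound \<open>aB'\<close>. If \<open>a\<close>
        pointed out of \<open>K\<close> at an active bound, this shifted vector would still lie in
        \<open>B\<close>.\<close>
      define t where "t = (- \<eta> - a \<bullet> s) / a $ i"
      have *: "- \<eta> - a \<bullet> s > 0" using aB'[OF sB] by simp
      have no: "s + axis i t \<notin> B" if "a $ i \<noteq> 0"
        using aB'[of "s + axis i t"] that by (auto simp: inner_add_right inner_axis t_def)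
      show "a $ i \<ge> 0 \<or> al $ i \<noteq> ereal (x $ i)"
      proof (rule ccontr)
        assume "\<not> ?thesis"
        then have i: "a $ i < 0" "al $ i = ereal (x $ i)" by auto
        then have "t < 0" using * by (simp add: t_def divide_pos_neg)
        then have "s + axis i t \<in> B"
          using s i unfolding B by (auto simp: axis_def) (smt (verit))
        then show False using no i by simp
      qed
      show "a $ i \<le> 0 \<or> au $ i \<noteq> ereal (x $ i)"
      proof (rule ccontr)
        assume "\<not> ?thesis"
        then have i: "a $ i > 0" "au $ i = ereal (x $ i)" by auto
        then have "t > 0" using * by (simp add: t_def)
        then have "s + axis i t \<in> B"
          using s i unfolding B by (auto simp: axis_def) (smt (verit))
        then show False using no i by simp
      qed
    qed
    \<comment> \<open>The one-sided derivative of the primal objective at \<open>x\<close> along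
      \<open>a\<close>; separation makes it negative.\<close>
    define \<kappa> where "\<kappa> = a \<bullet> (c + Q *v x + s)"
    have \<kappa>: "\<kappa> < 0" using a aB'[OF sB] by (simp add: \<kappa>_def inner_add_right)
    have xt: "((\<lambda>e. x $ i + e * a $ i) \<longlongrightarrow> x $ i) (at_right 0)" for i
      by (rule tendsto_eq_intros refl | simp)+
    have ext: "((\<lambda>e. ereal (x $ i + e * a $ i)) \<longlongrightarrow> ereal (x $ i)) (at_right 0)" for i
      using xt by (rule tendsto_ereal)
    have pos: "\<forall>\<^sub>F e::real in at_right 0. e > 0"
      by (simp add: eventually_at_right_less)
    have xK: "al $ i \<le> ereal (x $ i)" "ereal (x $ i) \<le> au $ i" for i
      using x(2) unfolding K box_set_def by auto
    have ev1: "\<forall>\<^sub>F e in at_right 0. al $ i \<le> ereal (x $ i + e * a $ i)" for i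
    proof (cases "al $ i = ereal (x $ i)")
      case True
      then have "a $ i \<ge> 0" using tangent(1)[of i] by auto
      then show ?thesis by (intro eventually_mono[OF pos]) (simp add: True)
    next
      case False
      then have "al $ i < ereal (x $ i)" using xK[of i] by auto
      from order_tendstoD(1)[OF ext this] show ?thesis by eventually_elim simp
    qed
    have ev2: "\<forall>\<^sub>F e in at_right 0. ereal (x $ i + e * a $ i) \<le> au $ i" for i
    proof (cases "au $ i = ereal (x $ i)")
      case True
      then have "a $ i \<le> 0" using tangent(2)[of i] by auto
      then show ?thesis by (intro eventually_mono[OF pos]) (simp add: True mult_nonneg_nonpos)
    next
      case False
      then have "ereal (x $ i) < au $ i" using xK[of i] by auto
      from order_tendstoD(2)[OF ext this] show ?thesis by eventually_elim simp
    qed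
    have ev3: "\<forall>\<^sub>F e in at_right 0. s $ i * (x $ i + e * a $ i) = d i * \<bar>x $ i + e * a $ i\<bar>" for i
    proof (cases "x $ i" "0::real" rule: linorder_cases)
      case less
      from order_tendstoD(2)[OF xt less] show ?thesis
        by eventually_elim (use less in \<open>simp add: s_def algebra_simps\<close>)
    next
      case equal
      from pos show ?thesis
        by eventually_elim (simp add: s_def equal abs_mult sgn_mult linordered_idom_class.abs_sgn)
    next
      case greater
      from order_tendstoD(1)[OF xt greater] show ?thesis
        by eventually_elim (use greater in \<open>simp add: s_def\<close>)
    qed
    have "((\<lambda>e. \<kappa> + e / 2 * (a \<bullet> (Q *v a))) \<longlongrightarrow> \<kappa>) (at_right 0)"
      by (rule tendsto_eq_intros refl | simp)+
    from order_tendstoD(2)[OF this \<kappa>]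
    have ev4: "\<forall>\<^sub>F e in at_right 0. \<kappa> + e / 2 * (a \<bullet> (Q *v a)) < 0" .
    have "\<forall>\<^sub>F e in at_right 0. e > 0 \<and> (\<forall>i. al $ i \<le> ereal (x $ i + e * a $ i)) \<and>
        (\<forall>i. ereal (x $ i + e * a $ i) \<le> au $ i) \<and>
        (\<forall>i. s $ i * (x $ i + e * a $ i) = d i * \<bar>x $ i + e * a $ i\<bar>) \<and> \<kappa> + e / 2 * (a \<bullet> (Q *v a)) < 0"
      by (intro eventually_conj pos eventually_all_finite ev1 ev2 ev3 ev4)
    from eventually_happens'[OF trivial_limit_at_right_real this]
    obtain e where e: "e > 0" "\<And>i. al $ i \<le> ereal (x $ i + e * a $ i)"
        "\<And>i. ereal (x $ i + e * a $ i) \<le> au $ i"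
        "\<And>i. s $ i * (x $ i + e * a $ i) = d i * \<bar>x $ i + e * a $ i\<bar>"
        "\<kappa> + e / 2 * (a \<bullet> (Q *v a)) < 0"
      by metis
    define u where "u = x + e *\<^sub>R a"
    have "u \<in> K" using e(2,3) by (simp add: K box_set_def u_def)
    moreover have "A *v u = b"
      using x(1) Aa by (simp add: u_def matrix_vector_right_distrib matrix_vector_mult_scaleR)
    ultimately have le: "c \<bullet> x + 1/2 * (x \<bullet> (Q *v x)) + reg D x \<le> c \<bullet> u + 1/2 * (u \<bullet> (Q *v u)) + reg D u"
      by (rule min)
    have "reg D u = s \<bullet> u"
      using e(4) by (simp add: reg_diagonal[OF D] inner_vec_def u_def d_def)
    moreover have "reg D x = s \<bullet> x"
      unfolding reg_diagonal[OF D] inner_vec_def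
      by (intro sum.cong) (auto simp: s_def d_def sgn_if)
    ultimately have "reg D u - reg D x \<le> e * (s \<bullet> a)"
      by (simp add: u_def inner_add_right)
    moreover have "1/2 * (u \<bullet> (Q *v u)) = 1/2 * (x \<bullet> (Q *v x)) + e * (a \<bullet> (Q *v x)) + e * (e / 2 * (a \<bullet> (Q *v a)))"
      using psd_inner_commute[OF Q, of x a]
      by (simp add: u_def inner_add_left inner_add_right matrix_vector_right_distrib
          matrix_vector_mult_scaleR inner_commute algebra_simps)
    ultimately have "0 \<le> e * (\<kappa> + e / 2 * (a \<bullet> (Q *v a)))"
      using le by (simp add: u_def \<kappa>_def inner_add_right inner_commute algebra_simps)
    then show False using e(1,5) by (simp add: zero_le_mult_iff)
  qed
  then obtain y v where v: "v \<in> B" and yv: "c + Q *v x = transpose A *v y - v"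
    unfolding S_def g_def by auto
  \<comment> \<open>Split \<open>v\<close> by clamping it to the subgradient intervals. The
    remainder \<open>z\<close> is nonzero only where \<open>v\<close> leaves its interval, which
    membership in \<open>B\<close> permits only at an active bound and with the sign of an outward
    normal.\<close>
  define s where "s = (\<chi> i. max (lo i) (min (hi i) (v $ i)))"
  define z where "z = v - s"
  have "z $ i * (u $ i - x $ i) \<le> 0" if "u \<in> K" for u i
  proof -
    have u: "al $ i \<le> ereal (u $ i)" "ereal (u $ i) \<le> au $ i" using that by (auto simp: K box_set_def)
    have "z $ i = 0 \<or> z $ i < 0 \<and> v $ i < lo i \<or> z $ i > 0 \<and> v $ i > hi i"
      using lohi[of i] by (auto simp: z_def s_def max_def min_def)
    then consider "z $ i = 0" | "z $ i < 0" "v $ i < lo i" | "z $ i > 0" "v $ i > hi i"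
      by blast
    then show ?thesis
    proof cases
      case 2
      then have "al $ i = ereal (x $ i)" using v B by (auto simp: not_le[symmetric])
      then show ?thesis using u 2 by (simp add: mult_nonpos_nonneg)
    next
      case 3
      then have "au $ i = ereal (x $ i)" using v B by (auto simp: not_le[symmetric])
      then show ?thesis using u 3 by (simp add: mult_nonneg_nonpos)
    qed simp
  qed
  then have "\<forall>u\<in>K. z \<bullet> (u - x) \<le> 0"
    by (auto simp: inner_vec_def intro: sum_nonpos)
  moreover have "s \<in> subdifferential (reg D) x"
    using lohi by (intro sub) (simp_all add: s_def)
  moreover have "transpose A *v y - c - Q *v x - z = s"
    using yv by (simp add: z_def algebra_simps)
  ultimately have "kkt_point c Q A b D K (x, y, z)"
    using x by (simp add: kkt_point_def del: transpose_matrix_vector)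
  then show ?thesis by blast
qed

text \<open>A finite dual value at \<open>(p, y, z)\<close> makes both conjugates real. Their
  Fenchel inequalities then give the lower bound, affine in \<open>Q *v u\<close>, from which a
  primal minimizer is obtained; its multipliers need not be the given dual point.\<close>

lemma kkt_point_exists:
  fixes Q D :: "real ^ 'n ^ 'n" and A :: "real ^ 'n ^ 'm"
  assumes Q: "psd Q" and D: "diagonal D" "psd D" and K: "K = box_set al au"
    and primal: "\<exists>x. primal_feasible_point c Q A b D K x"
    and dual: "\<exists>w. dual_feasible_point c Q A b D K w"
  shows "\<exists>w. kkt_point c Q A b D K w"
proof -
  obtain u0 where u0: "A *v u0 = b" "u0 \<in> K" using primal by (auto simp: primal_feasible_point_iff)
  obtain p y z where w: "dual_feasible_point c Q A b D K (p, y, z)" using dual by auto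
  define s where "s = transpose A *v y - c - Q *v p - z"
  define a where "a = fenchel_conjugate (convex_indicator K) z"
  define e where "e = fenchel_conjugate (\<lambda>x. ereal (reg D x)) s"
  have a: "ereal (z \<bullet> u) \<le> a" if "u \<in> K" for u
    unfolding a_def using that by (rule conjugate_indicator_ge)
  have e: "ereal (s \<bullet> u - reg D u) \<le> e" for u
    unfolding e_def by (rule conjugate_real_ge)
  have "\<bar>ereal (b \<bullet> y - 1/2 * (p \<bullet> (Q *v p))) - a - e\<bar> \<noteq> \<infinity>"
    using w by (simp add: dual_feasible_point_def dual_objective_def a_def e_def s_def)
  moreover have "a \<noteq> - \<infinity>" using a[OF u0(2)] by auto
  moreover have "e \<noteq> - \<infinity>" using e[of u0] by auto
  ultimately obtain \<alpha> \<gamma> where fin: "a = ereal \<alpha>" "e = ereal \<gamma>" by (cases a; cases e) auto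
  have "b \<bullet> y - p \<bullet> (Q *v p) - \<alpha> - \<gamma> + p \<bullet> (Q *v p) - p \<bullet> (Q *v u) \<le> c \<bullet> u + reg D u" if u: "u \<in> K" "A *v u = b" for u
  proof -
    have "z \<bullet> u \<le> \<alpha>" "s \<bullet> u - reg D u \<le> \<gamma>" using a[OF u(1)] e[of u] fin by auto
    moreover have "s \<bullet> u = b \<bullet> y - c \<bullet> u - p \<bullet> (Q *v u) - z \<bullet> u"
      using psd_inner_commute[OF Q, of p u] u(2)
      by (simp add: s_def inner_diff_left dot_lmul_matrix inner_commute[of b])
    ultimately show ?thesis by simp
  qed
  then have "b \<bullet> y - \<alpha> - \<gamma> - p \<bullet> (Q *v u) \<le> c \<bullet> u + reg D u" if "u \<in> K" "A *v u = b" for u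
    using that by force
  from primal_minimizer_exists[OF Q K u0 this]
  obtain x where x: "x \<in> K" "A *v x = b" "\<And>u. u \<in> K \<Longrightarrow> A *v u = b \<Longrightarrow>
      c \<bullet> x + 1/2 * (x \<bullet> (Q *v x)) + reg D x \<le> c \<bullet> u + 1/2 * (u \<bullet> (Q *v u)) + reg D u"
    by blast
  have "\<exists>y z. kkt_point c Q A b D K (x, y, z)"
    by (rule multipliers_exist[OF Q D K x(2,1,3)])
  then show ?thesis by (elim exE) (rule exI)
qed

section \<open>Convergence of the proximal iteration\<close>

text \<open>The weighted metric is realized as the product norm of a linear image, so facts about
  norms apply unchanged.\<close>

definition scaled :: "real \<Rightarrow> 'a::real_normed_vector \<times> 'b::real_normed_vector \<Rightarrow> 'a \<times> 'b" where
  "scaled t w = (sqrt t *\<^sub>R fst w, snd w)"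

lemma norm_scaled_square: "0 \<le> t \<Longrightarrow> (norm (scaled t w))\<^sup>2 = t * (norm (fst w))\<^sup>2 + (norm (snd w))\<^sup>2"
  by (simp add: scaled_def norm_Pair power_mult_distrib)

lemma norm_scaled_mono: "0 \<le> s \<Longrightarrow> s \<le> t \<Longrightarrow> norm (scaled s w) \<le> norm (scaled t w)"
  by (rule power2_le_imp_le) (simp_all add: norm_scaled_square mult_right_mono)

text \<open>The factor \<open>min (sqrt t) 1\<close> is the one in the tolerance condition: it
  converts Euclidean errors to the weighted norm.\<close>

lemma norm_le_scaled: "0 \<le> t \<Longrightarrow> min (sqrt t) 1 * norm w \<le> norm (scaled t w)"
proof (rule power2_le_imp_le)
  assume t: "0 \<le> t"
  define m where "m = min (sqrt t) 1"
  have m: "0 \<le> m" using t by (simp add: m_def)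
  have "m\<^sup>2 \<le> (sqrt t)\<^sup>2" "m\<^sup>2 \<le> 1\<^sup>2"
    using m by (intro power_mono; simp add: m_def)+
  then have "m\<^sup>2 * (norm (fst w))\<^sup>2 \<le> t * (norm (fst w))\<^sup>2" "m\<^sup>2 * (norm (snd w))\<^sup>2 \<le> 1 * (norm (snd w))\<^sup>2"
    using t by (intro mult_right_mono; simp)+
  moreover have "(norm w)\<^sup>2 = (norm (fst w))\<^sup>2 + (norm (snd w))\<^sup>2"
    by (cases w) (simp add: norm_Pair)
  ultimately show "(min (sqrt t) 1 * norm w)\<^sup>2 \<le> (norm (scaled t w))\<^sup>2"
    using t by (simp add: norm_scaled_square power_mult_distrib distrib_left m_def)
qed simp

lemma scaled_le_norm:
  assumes "0 \<le> t"
  shows "norm (scaled t w) \<le> (sqrt t + 1) * norm w"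
proof -
  have "norm (scaled t w) \<le> norm (sqrt t *\<^sub>R fst w) + norm (snd w)"
    unfolding scaled_def by (rule norm_Pair_le)
  also have "\<dots> \<le> sqrt t * norm w + norm w"
    using assms norm_fst_le[of "fst w" "snd w"] norm_snd_le[of "snd w" "fst w"]
    by (intro add_mono) (auto intro: mult_left_mono)
  finally show ?thesis by (simp add: distrib_right)
qed

text \<open>The three-point identity of the weighted inner product, by which monotonicity becomes a
  statement about distances.\<close>

lemma scaled_polarization:
  assumes "0 \<le> t"
  shows "2 * (t * ((fst p - fst q) \<bullet> (fst p - fst r)) + (snd p - snd q) \<bullet> (snd p - snd r)) =
    (norm (scaled t (p - r)))\<^sup>2 + (norm (scaled t (p - q)))\<^sup>2 - (norm (scaled t (q - r)))\<^sup>2"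
  unfolding norm_scaled_square[OF assms] unfolding power2_norm_eq_inner
  by (simp add: inner_diff_left inner_diff_right inner_commute algebra_simps)

text \<open>Here \<open>m k\<close> is meant as the new distance in the old metric and
  \<open>a (Suc k)\<close> as the same distance in the new one. If \<open>m k\<close> exceeded
  \<open>a k + \<delta> k\<close>, the right side of \<open>step\<close> would be less than
  \<open>(m k)\<^sup>2\<close>. So \<open>a\<close> minus the partial sums of \<delta> decreases and
  is bounded below, and \<open>r\<close> is squeezed by differences that vanish.\<close>

lemma perturbed_fejer_sequence:
  fixes a m r \<delta> :: "nat \<Rightarrow> real"
  assumes nonneg: "\<And>k. 0 \<le> a k" "\<And>k. 0 \<le> \<delta> k" and sm: "summable \<delta>"
    and am: "\<And>k. a (Suc k) \<le> m k"
    and step: "\<And>k. (m k)\<^sup>2 + (r k)\<^sup>2 \<le> (a k)\<^sup>2 + \<delta> k * m k"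
  shows "convergent a" "r \<longlonglongrightarrow> 0"
proof -
  have m0: "0 \<le> m k" for k using nonneg(1) am order_trans by blast
  have ma: "m k \<le> a k + \<delta> k" for k
  proof (rule ccontr)
    assume "\<not> ?thesis"
    then have lt: "a k + \<delta> k < m k" by simp
    have "(a k)\<^sup>2 + \<delta> k * m k \<le> a k * m k + \<delta> k * m k"
      using lt nonneg[of k] by (simp add: power2_eq_square mult_left_mono)
    also have "\<dots> < m k * m k"
      using lt nonneg[of k] by (simp flip: distrib_right)
    finally show False
      using step[of k] zero_le_power2[of "r k"] unfolding power2_eq_square by linarith
  qed
  define b where "b k = a k - (\<Sum>j<k. \<delta> j)" for k
  have "decseq b"
    unfolding decseq_Suc_iff using order_trans[OF am ma] by (simp add: b_def algebra_simps)
  moreover have "- suminf \<delta> \<le> b k" for k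
    using nonneg(1)[of k] sum_le_suminf[OF sm, of "{..<k}"] nonneg(2) by (simp add: b_def)
  ultimately have "convergent b"
    using decseq_convergent[of b "- suminf \<delta>"] unfolding convergent_def by metis
  moreover have "convergent (\<lambda>k. \<Sum>j<k. \<delta> j)"
    using sm by (simp add: summable_iff_convergent)
  ultimately have "convergent (\<lambda>k. b k + (\<Sum>j<k. \<delta> j))" by (rule convergent_add)
  then show conv: "convergent a" by (simp add: b_def)
  then obtain L where L: "a \<longlonglongrightarrow> L" by (auto simp: convergent_def)
  have \<delta>0: "\<delta> \<longlonglongrightarrow> 0" using sm by (rule summable_LIMSEQ_zero)
  have "(\<lambda>k. (a k)\<^sup>2 - (a (Suc k))\<^sup>2 + \<delta> k * (a k + \<delta> k)) \<longlonglongrightarrow> L\<^sup>2 - L\<^sup>2 + 0 * (L + 0)"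
    by (intro tendsto_intros L \<delta>0 LIMSEQ_Suc[OF L])
  then have lim: "(\<lambda>k. (a k)\<^sup>2 - (a (Suc k))\<^sup>2 + \<delta> k * (a k + \<delta> k)) \<longlonglongrightarrow> 0" by simp
  have "(r k)\<^sup>2 \<le> (a k)\<^sup>2 - (a (Suc k))\<^sup>2 + \<delta> k * (a k + \<delta> k)" for k
  proof -
    have "(a (Suc k))\<^sup>2 \<le> (m k)\<^sup>2" using am nonneg by (simp add: power_mono)
    moreover have "\<delta> k * m k \<le> \<delta> k * (a k + \<delta> k)" using ma nonneg by (simp add: mult_left_mono)
    ultimately show ?thesis using step[of k] by linarith
  qed
  then have "(\<lambda>k. (r k)\<^sup>2) \<longlonglongrightarrow> 0"
    by (intro real_tendsto_sandwich[OF _ _ tendsto_const lim]) auto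
  then show "r \<longlonglongrightarrow> 0"
    using tendsto_real_sqrt[of "\<lambda>k. (r k)\<^sup>2" 0] by (simp add: tendsto_rabs_zero_iff)
qed

section \<open>Steps of the algorithm and their limits\<close>

lemma pd_pmm_run_step:
  assumes run: "pd_pmm_run c Q A b D K \<tau> \<beta> \<epsilon> x y z"
    and K: "convex K" "closed K" "K \<noteq> {}" and pos: "\<beta> k > 0" "\<epsilon> k > 0"
  shows "\<exists>u v s p. norm (u, v) \<le> 2 * \<epsilon> k \<and> s \<in> subdifferential (reg D) (x (Suc k)) \<and>
    p \<in> K \<and> (\<forall>w\<in>K. z (Suc k) \<bullet> (w - p) \<le> 0) \<and>
    u = c + Q *v x (Suc k) - transpose A *v y (Suc k) + z (Suc k)
      + (\<tau> k / \<beta> k) *\<^sub>R (x (Suc k) - x k) + s \<and>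
    v = A *v x (Suc k) + (y (Suc k) - y k) /\<^sub>R \<beta> k - b \<and>
    z (Suc k) = z k + \<beta> k *\<^sub>R (x (Suc k) - p)"
proof -
  define E where "E = pmm_operator c Q A b D K (\<beta> k) (\<beta> k / \<tau> k) (x k) (y k) (z k) (x (Suc k)) (y (Suc k))"
  define t where "t = inverse (\<beta> k) *\<^sub>R z k + x (Suc k)"
  define p where "p = closest_point K t"
  have z: "z (Suc k) = (z k + \<beta> k *\<^sub>R x (Suc k)) - \<beta> k *\<^sub>R p"
    and "infdist 0 E \<le> \<epsilon> k"
    using run unfolding pd_pmm_run_def E_def p_def t_def by auto
  \<comment> \<open>Doubling the positive tolerance makes the inequality strict, so some element of
    \<open>E\<close> satisfies it without any argument that the infimum is attained.\<close>
  then have "infdist 0 E < 2 * \<epsilon> k" using pos by simp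
  moreover have "E \<noteq> {}" unfolding E_def by (rule pmm_operator_nonempty)
  moreover have "bdd_below (dist 0 ` E)" by (rule bdd_belowI[of _ 0]) auto
  ultimately obtain w where w: "w \<in> E" "dist 0 w < 2 * \<epsilon> k"
    by (auto simp: infdist_notempty cInf_less_iff)
  obtain u v where uv: "w = (u, v)" by (cases w)
  obtain s where s: "s \<in> subdifferential (reg D) (x (Suc k))"
      "u = c + Q *v x (Suc k) - transpose A *v y (Suc k) + (z k + \<beta> k *\<^sub>R x (Suc k) - \<beta> k *\<^sub>R p)
        + inverse (\<beta> k / \<tau> k) *\<^sub>R (x (Suc k) - x k) + s"
      "v = A *v x (Suc k) + inverse (\<beta> k) *\<^sub>R (y (Suc k) - y k) - b"
    using w(1) unfolding uv E_def pmm_operator_def pmm_residual_def p_def t_def by auto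
  have zt: "z (Suc k) = \<beta> k *\<^sub>R (t - p)"
    using pos by (simp add: z t_def algebra_simps)
  have "z (Suc k) \<bullet> (w - p) \<le> 0" if "w \<in> K" for w
    using closest_point_dot[OF K(1,2) that, of t] pos
    by (simp add: zt p_def mult_nonneg_nonpos)
  moreover have "p \<in> K" unfolding p_def using K by (simp add: closest_point_in_set)
  moreover have "norm (u, v) \<le> 2 * \<epsilon> k" using w(2) uv by simp
  moreover have "z (Suc k) = z k + \<beta> k *\<^sub>R (x (Suc k) - p)" by (simp add: z algebra_simps)
  moreover have "u = c + Q *v x (Suc k) - transpose A *v y (Suc k) + z (Suc k)
      + (\<tau> k / \<beta> k) *\<^sub>R (x (Suc k) - x k) + s"
    unfolding s(2) z by simp
  ultimately show ?thesis using s(1,3) by blast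
qed

lemma subdifferential_monotone:
  assumes "s \<in> subdifferential f x" "t \<in> subdifferential f u"
  shows "0 \<le> (s - t) \<bullet> (x - u)"
proof -
  have "f x + s \<bullet> (u - x) \<le> f u" "f u + t \<bullet> (x - u) \<le> f x"
    using assms by (auto simp: subdifferential_def)
  then show ?thesis by (simp add: inner_diff_left inner_diff_right)
qed

text \<open>Pairing the residuals with the distance to a KKT point cancels the \<open>A\<close>
  terms and leaves three nonnegative ones, from \<open>Q\<close>, the subdifferential and the normal
  cone. The proximal terms that remain are rewritten by the three-point identity.\<close>

lemma kkt_point_fejer:
  fixes \<beta> \<tau> :: real
  assumes Q: "psd Q" and pos: "\<beta> > 0" "\<tau> > 0"
    and kkt: "kkt_point c Q A b D K w"
    and s: "s \<in> subdifferential (reg D) x'" and p: "p \<in> K" "\<forall>w\<in>K. z' \<bullet> (w - p) \<le> 0"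
    and u: "u = c + Q *v x' - transpose A *v y' + z' + (\<tau> / \<beta>) *\<^sub>R (x' - x) + s"
    and v: "v = A *v x' + (y' - y) /\<^sub>R \<beta> - b"
    and z': "z' = z + \<beta> *\<^sub>R (x' - p)"
  shows "(norm (scaled \<tau> ((x', y', z') - w)))\<^sup>2 + (norm (scaled \<tau> ((x', y', z') - (x, y, z))))\<^sup>2 \<le>
    (norm (scaled \<tau> ((x, y, z) - w)))\<^sup>2 + 2 * \<beta> * ((u, v) \<bullet> ((x', y') - (fst w, fst (snd w))))"
proof -
  obtain xs ys zs where w: "w = (xs, ys, zs)" by (cases w)
  define ss where "ss = transpose A *v ys - c - Q *v xs - zs"
  have k: "A *v xs = b" "xs \<in> K" "\<forall>u\<in>K. zs \<bullet> (u - xs) \<le> 0" "ss \<in> subdifferential (reg D) xs"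
    using kkt by (auto simp: kkt_point_def w ss_def)
  define h where "h = x' - xs"
  have 1: "0 \<le> h \<bullet> (Q *v h)" using Q by (rule psd_nonneg)
  have 2: "0 \<le> (s - ss) \<bullet> h" unfolding h_def using s k(4) by (rule subdifferential_monotone)
  have 3: "0 \<le> (z' - zs) \<bullet> (p - xs)"
    using bspec[OF p(2) k(2)] bspec[OF k(3) p(1)] by (simp add: inner_diff_left inner_diff_right)
  have u': "u = Q *v h - transpose A *v (y' - ys) + (z' - zs) + (\<tau> / \<beta>) *\<^sub>R (x' - x) + (s - ss)"
    by (simp add: u ss_def h_def matrix_vector_mult_diff_distrib del: transpose_matrix_vector)
  have v': "v = A *v h + (y' - y) /\<^sub>R \<beta>"
    by (simp add: v h_def matrix_vector_mult_diff_distrib k(1))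
  \<comment> \<open>Monotonicity of the normal cone concerns \<open>p\<close>, while the residual is
    paired with \<open>x'\<close>; exchanging them produces the \<open>z\<close> part of the
    metric.\<close>
  have "\<beta> *\<^sub>R h = \<beta> *\<^sub>R (p - xs) + (z' - z)"
    by (simp add: z' h_def algebra_simps)
  then have "(z' - zs) \<bullet> (\<beta> *\<^sub>R h) = (z' - zs) \<bullet> (\<beta> *\<^sub>R (p - xs) + (z' - z))"
    by (rule arg_cong)
  then have zh: "\<beta> * ((z' - zs) \<bullet> h) = \<beta> * ((z' - zs) \<bullet> (p - xs)) + (z' - z) \<bullet> (z' - zs)"
    by (simp only: inner_scaleR_right inner_add_right inner_commute[of "z' - zs" "z' - z"])
  have "\<beta> * (u \<bullet> h) = \<beta> * (h \<bullet> (Q *v h)) - \<beta> * ((y' - ys) \<bullet> (A *v h)) + \<beta> * ((z' - zs) \<bullet> h)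
      + \<tau> * ((x' - x) \<bullet> h) + \<beta> * ((s - ss) \<bullet> h)"
    using pos unfolding u'
    by (simp only: inner_add_left inner_diff_left transpose_vector_inner inner_scaleR_left
        inner_commute[of "Q *v h" h] distrib_left right_diff_distrib) simp
  moreover have "\<beta> * (v \<bullet> (y' - ys)) = \<beta> * ((y' - ys) \<bullet> (A *v h)) + (y' - y) \<bullet> (y' - ys)"
    using pos unfolding v'
    by (simp add: inner_add_left inner_commute[of "A *v h"] distrib_left)
  ultimately have "\<tau> * ((x' - x) \<bullet> h) + ((y' - y) \<bullet> (y' - ys) + (z' - z) \<bullet> (z' - zs))
      \<le> \<beta> * (u \<bullet> h) + \<beta> * (v \<bullet> (y' - ys))"
    using zh 1 2 3 pos(1) by (simp add: add_nonneg_nonneg)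
  moreover have "(u, v) \<bullet> ((x', y') - (fst w, fst (snd w))) = u \<bullet> h + v \<bullet> (y' - ys)"
    by (simp add: w h_def)
  moreover have "2 * (\<tau> * ((x' - x) \<bullet> h) + ((y' - y) \<bullet> (y' - ys) + (z' - z) \<bullet> (z' - zs))) =
      (norm (scaled \<tau> ((x', y', z') - w)))\<^sup>2 + (norm (scaled \<tau> ((x', y', z') - (x, y, z))))\<^sup>2
      - (norm (scaled \<tau> ((x, y, z) - w)))\<^sup>2"
    unfolding scaled_polarization[OF less_imp_le[OF pos(2)], symmetric] by (simp add: w h_def)
  ultimately show ?thesis by (simp add: distrib_left)
qed

lemma subdifferential_closed_graph:
  assumes "continuous_on UNIV f" "x \<longlonglongrightarrow> l" "s \<longlonglongrightarrow> t" "\<And>k::nat. s k \<in> subdifferential f (x k)"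
  shows "t \<in> subdifferential f l"
proof -
  have fx: "(\<lambda>k. f (x k)) \<longlonglongrightarrow> f l"
    using continuous_on_tendsto_compose[OF assms(1,2)] by simp
  have "f l + t \<bullet> (w - l) \<le> f w" for w
  proof (rule LIMSEQ_le_const2)
    show "(\<lambda>k. f (x k) + s k \<bullet> (w - x k)) \<longlonglongrightarrow> f l + t \<bullet> (w - l)"
      by (intro tendsto_intros fx assms)
    show "\<exists>N. \<forall>k\<ge>N. f (x k) + s k \<bullet> (w - x k) \<le> f w"
      using assms(4) by (simp add: subdifferential_def)
  qed
  then show ?thesis by (simp add: subdifferential_def)
qed

text \<open>Closedness of the graph of the KKT operator. With bounded inverses of \<beta> and
  bounded \<tau>, vanishing increments remove the proximal terms and force \<open>p\<close> to the
  same limit as \<open>x'\<close>.\<close>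

lemma kkt_point_limit:
  fixes x x' z z' :: "nat \<Rightarrow> real ^ 'n" and y y' :: "nat \<Rightarrow> real ^ 'm" and B :: real
  assumes K: "closed K"
    and lim: "(\<lambda>k. (x' k, y' k, z' k)) \<longlonglongrightarrow> l"
    and diff: "(\<lambda>k. (x' k, y' k, z' k) - (x k, y k, z k)) \<longlonglongrightarrow> 0"
    and uv: "(\<lambda>k. (u k, v k)) \<longlonglongrightarrow> 0"
    and \<beta>: "\<And>k. 0 < \<beta> k" "\<And>k. inverse (\<beta> k) \<le> B" and \<tau>: "\<And>k. 0 < \<tau> k" "\<And>k. \<tau> k \<le> T"
    and s: "\<And>k. s k \<in> subdifferential (reg D) (x' k)"
    and p: "\<And>k. p k \<in> K" "\<And>k. \<forall>w\<in>K. z' k \<bullet> (w - p k) \<le> 0"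
    and u: "\<And>k. u k = c + Q *v x' k - transpose A *v y' k + z' k + (\<tau> k / \<beta> k) *\<^sub>R (x' k - x k) + s k"
    and v: "\<And>k. v k = A *v x' k + (y' k - y k) /\<^sub>R \<beta> k - b"
    and z: "\<And>k. z' k = z k + \<beta> k *\<^sub>R (x' k - p k)"
  shows "kkt_point c Q A b D K l"
proof -
  obtain xl yl zl where l: "l = (xl, yl, zl)" by (cases l)
  have lims: "x' \<longlonglongrightarrow> xl" "y' \<longlonglongrightarrow> yl" "z' \<longlonglongrightarrow> zl"
    using tendsto_fst[OF lim] tendsto_fst[OF tendsto_snd[OF lim]] tendsto_snd[OF tendsto_snd[OF lim]]
    by (simp_all add: l)
  have diffs: "(\<lambda>k. x' k - x k) \<longlonglongrightarrow> 0" "(\<lambda>k. y' k - y k) \<longlonglongrightarrow> 0" "(\<lambda>k. z' k - z k) \<longlonglongrightarrow> 0"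
    using tendsto_fst[OF diff] tendsto_fst[OF tendsto_snd[OF diff]] tendsto_snd[OF tendsto_snd[OF diff]]
    by simp_all
  have uv0: "u \<longlonglongrightarrow> 0" "v \<longlonglongrightarrow> 0"
    using tendsto_fst[OF uv] tendsto_snd[OF uv] by simp_all
  have bdd: "(\<lambda>k. r k *\<^sub>R f k) \<longlonglongrightarrow> 0"
    if "f \<longlonglongrightarrow> 0" "\<And>k. \<bar>r k\<bar> \<le> R" for f :: "nat \<Rightarrow> 'a::real_normed_vector" and r R
  proof (rule Lim_null_comparison[OF always_eventually])
    show "\<forall>k. norm (r k *\<^sub>R f k) \<le> R * norm (f k)" using that(2) by (simp add: mult_right_mono)
    show "(\<lambda>k. R * norm (f k)) \<longlonglongrightarrow> 0"
      using tendsto_mult[OF tendsto_const[of R] tendsto_norm_zero[OF that(1)]] by simp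
  qed
  have b\<beta>: "\<bar>inverse (\<beta> k)\<bar> \<le> B" for k using \<beta>[of k] by simp
  have bt: "\<bar>\<tau> k / \<beta> k\<bar> \<le> T * B" for k
    using \<beta>[of k] \<tau>[of k] mult_mono[of "\<tau> k" T "inverse (\<beta> k)" B] by (simp add: divide_inverse)
  have mv: "(\<lambda>k. M *v f k) \<longlonglongrightarrow> M *v a" if "f \<longlonglongrightarrow> a"
    for M :: "real ^ 'i ^ 'j" and f :: "nat \<Rightarrow> real ^ 'i" and a
    using that by (rule bounded_linear.tendsto[OF matrix_vector_mul_bounded_linear])
  have "(\<lambda>k. A *v x' k + (y' k - y k) /\<^sub>R \<beta> k - b) \<longlonglongrightarrow> A *v xl + 0 - b"
    by (intro tendsto_intros mv lims bdd[OF diffs(2) b\<beta>])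
  then have "v \<longlonglongrightarrow> A *v xl + 0 - b"
    by (simp only: v[symmetric])
  then have "A *v xl = b"
    using LIMSEQ_unique[OF uv0(2)] by force
  moreover have "(\<lambda>k. u k - c - Q *v x' k + transpose A *v y' k - z' k - (\<tau> k / \<beta> k) *\<^sub>R (x' k - x k))
      \<longlonglongrightarrow> 0 - c - Q *v xl + transpose A *v yl - zl - 0"
    by (intro tendsto_intros mv lims uv0 bdd[OF diffs(1) bt])
  then have "s \<longlonglongrightarrow> transpose A *v yl - c - Q *v xl - zl"
    unfolding u by (simp add: algebra_simps del: transpose_matrix_vector)
  then have "transpose A *v yl - c - Q *v xl - zl \<in> subdifferential (reg D) xl"
    by (rule subdifferential_closed_graph[OF continuous_reg lims(1) _ s])
  moreover have plim: "p \<longlonglongrightarrow> xl"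
  proof -
    have "p = (\<lambda>k. x' k - (z' k - z k) /\<^sub>R \<beta> k)"
      using less_imp_neq[OF \<beta>(1)] by (intro ext) (simp add: z)
    moreover have "(\<lambda>k. x' k - (z' k - z k) /\<^sub>R \<beta> k) \<longlonglongrightarrow> xl - 0"
      by (intro tendsto_intros lims bdd[OF diffs(3) b\<beta>])
    ultimately show ?thesis by simp
  qed
  then have "xl \<in> K" using closed_sequentially[OF K _ plim] p(1) by simp
  moreover have "zl \<bullet> (w - xl) \<le> 0" if "w \<in> K" for w
  proof (rule LIMSEQ_le_const2)
    show "(\<lambda>k. z' k \<bullet> (w - p k)) \<longlonglongrightarrow> zl \<bullet> (w - xl)" by (intro tendsto_intros lims plim)
    show "\<exists>N. \<forall>k\<ge>N. z' k \<bullet> (w - p k) \<le> 0" using p(2) that by blast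
  qed
  ultimately show ?thesis by (simp add: kkt_point_def l del: transpose_matrix_vector)
qed

theorem theorem2p2:
  fixes c :: "real ^ 'n"
    and Q D :: "real ^ 'n ^ 'n"
    and A :: "real ^ 'n ^ 'm"
    and b :: "real ^ 'm"
    and al au :: "ereal ^ 'n"
    and K :: "(real ^ 'n) set"
    and \<tau> \<beta> \<epsilon> \<delta> :: "nat \<Rightarrow> real"
    and \<tau>inf :: real
    and \<beta>inf :: ereal
    and x z :: "nat \<Rightarrow> real ^ 'n"
    and y :: "nat \<Rightarrow> real ^ 'm"
  assumes "K = box_set al au"
    and "CARD('m) \<le> CARD('n)"
    and "psd Q"
    and "diagonal D" and "psd D"
    and "\<forall>i. al $ i \<le> au $ i"
    and "\<exists>x. primal_feasible_point c Q A b D K x"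
    and "\<exists>w. dual_feasible_point c Q A b D K w"
    and "\<forall>k. \<tau> k > 0" and "decseq \<tau>" and "\<tau> \<longlonglongrightarrow> \<tau>inf" and "\<tau>inf > 0"
    and "\<beta> 0 > 0" and "incseq \<beta>" and "(\<lambda>k. ereal (\<beta> k)) \<longlonglongrightarrow> \<beta>inf"
    and "\<forall>k. \<epsilon> k > 0" and "\<epsilon> \<longlonglongrightarrow> 0"
    and "pd_pmm_run c Q A b D K \<tau> \<beta> \<epsilon> x y z"
    and "\<forall>k. \<epsilon> k \<le> min (sqrt (\<tau> k)) 1 / \<beta> k * \<delta> k"
    and "\<forall>k. 0 \<le> \<delta> k" and "summable \<delta>"
  shows "bounded (range (\<lambda>k. (x k, y k, z k))) \<and>
    (\<exists>w. (\<lambda>k. (x k, y k, z k)) \<longlonglongrightarrow> w \<and> primal_dual_solution c Q A b D K w)"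
proof -
  have K: "convex K" "closed K" "K \<noteq> {}"
    using polyhedron_box_set[of al au] \<open>\<exists>x. primal_feasible_point c Q A b D K x\<close>
    by (auto simp: \<open>K = box_set al au\<close> polyhedron_imp_convex polyhedron_imp_closed primal_feasible_point_iff)
  have \<beta>0: "\<beta> 0 \<le> \<beta> k" for k using \<open>incseq \<beta>\<close> by (simp add: incseq_def)
  have \<beta>: "0 < \<beta> k" "inverse (\<beta> k) \<le> inverse (\<beta> 0)" for k
    using \<beta>0[of k] \<open>\<beta> 0 > 0\<close> by (auto intro: le_imp_inverse_le)
  have \<tau>: "0 < \<tau> k" "\<tau> k \<le> \<tau> 0" "\<tau>inf \<le> \<tau> k" "\<tau> (Suc k) \<le> \<tau> k" for k
    using \<open>\<forall>k. \<tau> k > 0\<close> \<open>decseq \<tau>\<close> decseq_ge[OF \<open>decseq \<tau>\<close> \<open>\<tau> \<longlonglongrightarrow> \<tau>inf\<close>]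
    by (auto simp: decseq_def)
  define w where "w k = (x k, y k, z k)" for k
  have "\<forall>k. \<exists>u v s p. norm (u, v) \<le> 2 * \<epsilon> k \<and> s \<in> subdifferential (reg D) (x (Suc k)) \<and>
    p \<in> K \<and> (\<forall>w\<in>K. z (Suc k) \<bullet> (w - p) \<le> 0) \<and>
    u = c + Q *v x (Suc k) - transpose A *v y (Suc k) + z (Suc k)
      + (\<tau> k / \<beta> k) *\<^sub>R (x (Suc k) - x k) + s \<and>
    v = A *v x (Suc k) + (y (Suc k) - y k) /\<^sub>R \<beta> k - b \<and>
    z (Suc k) = z k + \<beta> k *\<^sub>R (x (Suc k) - p)"
    using pd_pmm_run_step[OF \<open>pd_pmm_run c Q A b D K \<tau> \<beta> \<epsilon> x y z\<close> K \<beta>(1)] \<open>\<forall>k. \<epsilon> k > 0\<close> by blast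
  then obtain u v s p where
    uv: "\<And>k. norm (u k, v k) \<le> 2 * \<epsilon> k" and s: "\<And>k. s k \<in> subdifferential (reg D) (x (Suc k))" and
    p: "\<And>k. p k \<in> K" "\<And>k. \<forall>w\<in>K. z (Suc k) \<bullet> (w - p k) \<le> 0" and
    u: "\<And>k. u k = c + Q *v x (Suc k) - transpose A *v y (Suc k) + z (Suc k)
      + (\<tau> k / \<beta> k) *\<^sub>R (x (Suc k) - x k) + s k" and
    v: "\<And>k. v k = A *v x (Suc k) + (y (Suc k) - y k) /\<^sub>R \<beta> k - b" and
    z: "\<And>k. z (Suc k) = z k + \<beta> k *\<^sub>R (x (Suc k) - p k)"
    by metis
  have fejer: "(norm (scaled (\<tau> k) (w (Suc k) - q)))\<^sup>2 + (norm (scaled (\<tau> k) (w (Suc k) - w k)))\<^sup>2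
      \<le> (norm (scaled (\<tau> k) (w k - q)))\<^sup>2 + (4 * \<delta> k) * norm (scaled (\<tau> k) (w (Suc k) - q))"
    if q: "kkt_point c Q A b D K q" for q k
  proof -
    define e where "e = (x (Suc k), y (Suc k)) - (fst q, fst (snd q))"
    have "norm e \<le> norm (w (Suc k) - q)"
      by (cases q) (simp add: e_def w_def norm_Pair)
    then have "min (sqrt (\<tau> k)) 1 * norm e \<le> min (sqrt (\<tau> k)) 1 * norm (w (Suc k) - q)"
      using \<tau>[of k] by (intro mult_left_mono) auto
    also have "\<dots> \<le> norm (scaled (\<tau> k) (w (Suc k) - q))"
      using \<tau>(1)[of k] by (intro norm_le_scaled) simp
    finally have e: "min (sqrt (\<tau> k)) 1 * norm e \<le> norm (scaled (\<tau> k) (w (Suc k) - q))" .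
    have "(u k, v k) \<bullet> e \<le> norm (u k, v k) * norm e" by (rule norm_cauchy_schwarz)
    also have "\<dots> \<le> 2 * \<epsilon> k * norm e" using uv by (intro mult_right_mono) auto
    finally have "2 * \<beta> k * ((u k, v k) \<bullet> e) \<le> 2 * \<beta> k * (2 * \<epsilon> k * norm e)"
      using \<beta>(1)[of k] by (intro mult_left_mono) auto
    also have "\<dots> = 4 * (\<beta> k * \<epsilon> k) * norm e" by simp
    also have "\<dots> \<le> 4 * (min (sqrt (\<tau> k)) 1 * \<delta> k) * norm e"
      using \<open>\<forall>k. \<epsilon> k \<le> min (sqrt (\<tau> k)) 1 / \<beta> k * \<delta> k\<close>[rule_format, of k] \<beta>(1)[of k]
      by (intro mult_right_mono mult_left_mono) (auto simp: pos_le_divide_eq mult.commute)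
    also have "\<dots> = 4 * \<delta> k * (min (sqrt (\<tau> k)) 1 * norm e)" by simp
    also have "\<dots> \<le> 4 * \<delta> k * norm (scaled (\<tau> k) (w (Suc k) - q))"
      using e \<open>\<forall>k. 0 \<le> \<delta> k\<close> by (intro mult_left_mono) auto
    finally show ?thesis
      using kkt_point_fejer[OF \<open>psd Q\<close> \<beta>(1)[of k] \<tau>(1)[of k] q s[of k] p(1)[of k] p(2)[of k]
          u[of k] v[of k] z[of k]]
      unfolding w_def e_def by linarith
  qed
  have seq: "convergent (\<lambda>k. norm (scaled (\<tau> k) (w k - q)))"
    "(\<lambda>k. norm (scaled (\<tau> k) (w (Suc k) - w k))) \<longlonglongrightarrow> 0" if q: "kkt_point c Q A b D K q" for q
  proof -
    note * = perturbed_fejer_sequence[where a = "\<lambda>k. norm (scaled (\<tau> k) (w k - q))" and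
        m = "\<lambda>k. norm (scaled (\<tau> k) (w (Suc k) - q))" and \<delta> = "\<lambda>k. 4 * \<delta> k" and
        r = "\<lambda>k. norm (scaled (\<tau> k) (w (Suc k) - w k))",
        OF norm_ge_zero _ summable_mult[OF \<open>summable \<delta>\<close>]
          norm_scaled_mono[OF less_imp_le[OF \<tau>(1)] \<tau>(4)] fejer[OF q]]
    show "convergent (\<lambda>k. norm (scaled (\<tau> k) (w k - q)))"
      using \<open>\<forall>k. 0 \<le> \<delta> k\<close> by (intro *(1)) simp
    show "(\<lambda>k. norm (scaled (\<tau> k) (w (Suc k) - w k))) \<longlonglongrightarrow> 0"
      using \<open>\<forall>k. 0 \<le> \<delta> k\<close> by (intro *(2)) simp
  qed
  \<comment> \<open>Since \<tau> stays above its positive limit, this single constant compares all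
    the weighted norms with the Euclidean one.\<close>
  define \<mu> where "\<mu> = min (sqrt \<tau>inf) 1"
  have \<mu>: "\<mu> > 0" using \<open>\<tau>inf > 0\<close> by (simp add: \<mu>_def)
  have norm_le: "norm e \<le> norm (scaled (\<tau> k) e) / \<mu>" for e :: "(real ^ 'n) \<times> (real ^ 'm) \<times> (real ^ 'n)" and k
  proof -
    have "norm e * \<mu> \<le> norm (scaled \<tau>inf e)"
      unfolding \<mu>_def using norm_le_scaled[of \<tau>inf e] \<open>\<tau>inf > 0\<close> by (simp only: mult.commute less_imp_le)
    also have "\<dots> \<le> norm (scaled (\<tau> k) e)"
      using \<open>\<tau>inf > 0\<close> \<tau>(3) by (intro norm_scaled_mono) simp_all
    finally show ?thesis by (subst pos_le_divide_eq[OF \<mu>])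
  qed
  have null: "f \<longlonglongrightarrow> 0" if "(\<lambda>k. norm (scaled (\<tau> k) (f k))) \<longlonglongrightarrow> 0"
    for f :: "nat \<Rightarrow> (real ^ 'n) \<times> (real ^ 'm) \<times> (real ^ 'n)"
    by (rule Lim_null_comparison[OF always_eventually tendsto_divide_zero[OF that, of \<mu>]])
      (simp add: norm_le)
  obtain q where q: "kkt_point c Q A b D K q"
    using kkt_point_exists[OF \<open>psd Q\<close> \<open>diagonal D\<close> \<open>psd D\<close> \<open>K = box_set al au\<close>] assms(7,8) by blast
  have bdd: "bounded (range w)"
  proof -
    have "Bseq (\<lambda>k. norm (scaled (\<tau> k) (w k - q)))" using seq(1)[OF q] by (rule convergent_imp_Bseq)
    then obtain B where B: "\<And>k. norm (scaled (\<tau> k) (w k - q)) \<le> B" by (auto simp: Bseq_def)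
    have "norm (w k) \<le> norm q + B / \<mu>" for k
      using norm_triangle_sub[of "w k" q] norm_le[of "w k - q" k] divide_right_mono[OF B[of k], of \<mu>] \<mu>
      by linarith
    then show ?thesis unfolding bounded_iff by blast
  qed
  have step: "(\<lambda>k. w (Suc k) - w k) \<longlonglongrightarrow> 0" using seq(2)[OF q] by (rule null)
  obtain l r where r: "strict_mono r" and wl: "(\<lambda>k. w (r k)) \<longlonglongrightarrow> l"
    using bounded_imp_convergent_subsequence[OF bdd] unfolding comp_def by blast
  have stepr: "(\<lambda>k. w (Suc (r k)) - w (r k)) \<longlonglongrightarrow> 0"
    using LIMSEQ_subseq_LIMSEQ[OF step r] by (simp add: comp_def)
  \<comment> \<open>The inclusions of step \<open>r k\<close> hold at the iterate with index
    \<open>Suc (r k)\<close>, so the subsequence shifted by one must have the same limit.\<close>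
  have wl': "(\<lambda>k. w (Suc (r k))) \<longlonglongrightarrow> l"
    using tendsto_add[OF stepr wl] by simp
  have uv0: "(\<lambda>k. (u (r k), v (r k))) \<longlonglongrightarrow> 0"
  proof -
    have "(\<lambda>k. 2 * \<epsilon> (r k)) \<longlonglongrightarrow> 0"
      by (rule tendsto_mult_right_zero[OF LIMSEQ_subseq_LIMSEQ[OF \<open>\<epsilon> \<longlonglongrightarrow> 0\<close> r, unfolded comp_def]])
    then show ?thesis by (rule Lim_null_comparison[OF always_eventually, rotated]) (simp add: uv)
  qed
  have l: "kkt_point c Q A b D K l"
    by (rule kkt_point_limit[OF K(2) wl'[unfolded w_def] stepr[unfolded w_def] uv0, of "\<lambda>k. \<beta> (r k)"
          "inverse (\<beta> 0)" "\<lambda>k. \<tau> (r k)" "\<tau> 0" "\<lambda>k. s (r k)" D "\<lambda>k. p (r k)"]) (fact \<beta> \<tau> s p u v z)+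
  obtain L where L: "(\<lambda>k. norm (scaled (\<tau> k) (w k - l))) \<longlonglongrightarrow> L"
    using seq(1)[OF l] by (auto simp: convergent_def)
  \<comment> \<open>The weights are at most \<open>\<tau> 0\<close>, so Euclidean convergence of the
    subsequence carries over to the varying weighted norms and identifies the limit \<open>L\<close>
    of the full sequence of distances.\<close>
  have "(\<lambda>k. norm (scaled (\<tau> (r k)) (w (r k) - l))) \<longlonglongrightarrow> 0"
  proof (rule Lim_null_comparison[OF always_eventually])
    show "\<forall>k. norm (norm (scaled (\<tau> (r k)) (w (r k) - l))) \<le> (sqrt (\<tau> 0) + 1) * norm (w (r k) - l)"
      unfolding norm_ge_zero[THEN abs_of_nonneg] real_norm_def
      by (intro allI order_trans[OF norm_scaled_mono scaled_le_norm] \<tau>(2) less_imp_le[OF \<tau>(1)])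
    show "(\<lambda>k. (sqrt (\<tau> 0) + 1) * norm (w (r k) - l)) \<longlonglongrightarrow> 0"
      by (rule tendsto_mult_right_zero[OF tendsto_norm_zero[OF LIM_zero[OF wl]]])
  qed
  then have "L = 0"
    by (rule LIMSEQ_unique[OF LIMSEQ_subseq_LIMSEQ[OF L r, unfolded comp_def]])
  then have "w \<longlonglongrightarrow> l" using L by (intro LIM_zero_cancel[OF null]) simp
  with bdd kkt_point_imp_primal_dual_solution[OF \<open>psd Q\<close> l] show ?thesis
    unfolding w_def by (intro conjI exI[of _ l])
qed

end
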